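(* Let $m,n\ge 1$, $N=\min(m,n)$, $1\le K<N$, and let $F$ be a complex $m\times n$ matrix. The convex envelope $\mathcal I^{**}$ of the function $\mathcal I(A)=\mathcal R_K(A)+\|A-F\|^2$ on the space of complex $m\times n$ matrices is given by $$\mathcal I^{**}(A)=\frac{1}{k_*}\Bigl(\sum_{j=K-k_*+1}^{N}\alpha_j\Bigr)^2-\sum_{j=K-k_*+1}^{N}\alpha_j^2+\|A-F\|^2,$$ where $\alpha_1\ge\alpha_2\ge\dots\ge\alpha_N\ge 0$ are the singular values of $A$ and $k_*=k_*(\alpha)$ is the unique integer with $1\le k_*\le K$ satisfying $$\alpha_{K-k_*+1}\le \frac{1}{k_*}\sum_{j=K-k_*+1}^{N}\alpha_j<\alpha_{K-k_*},\qquad\text{with the convention }\alpha_0=\infty .$$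
   Context: $\|\cdot\|$ is the Frobenius norm on complex $m\times n$ matrices, and the space is regarded as a real Hilbert space with $\langle A,B\rangle=\operatorname{Re}\operatorname{tr}(B^*A)$. The function $\mathcal R_K$ is defined by $\mathcal R_K(A)=0$ if $\operatorname{rank}A\le K$ and $\mathcal R_K(A)=+\infty$ otherwise. The convex envelope of $\mathcal I$ is the largest convex function that is pointwise $\le\mathcal I$; it is the Fenchel bi-conjugate $\mathcal I^{**}=(\mathcal I^* )^*$, where the Fenchel conjugate is $f^*(B)=\sup_A\,(\langle A,B\rangle-f(A))$. The existence and uniqueness of $k_*$ for every nonincreasing nonnegative sequence $\alpha\in\mathbb R^N$ is a known fact: $k_*$ is the smallest $k\in\{1,\dots,K\}$ with $\frac1k\sum_{j=K-k+1}^N\alpha_j<\alpha_{K-k}$, and also the largest $k\in\{1,\dots,K\}$ with $\alpha_{K-k+1}\le \frac1k\sum_{j=K-k+1}^N\alpha_j$. *)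

theory Defs
  imports "HOL-Analysis.Analysis" "HOL-Computational_Algebra.Computational_Algebra"
begin

section \<open>Complex matrices as a real Hilbert space\<close>

text \<open>
  An \<open>m \<times> n\<close> complex matrix is an element of \<open>complex^'n^'m\<close>. The library's norm and
  inner product on this type are the Frobenius norm and \<open>\<langle>A, B\<rangle> = Re tr (B\<^sup>* A)\<close>, as the two
  lemmas below confirm.
\<close>

definition ctranspose :: "complex^'n^'m \<Rightarrow> complex^'m^'n" where
  "ctranspose A = (\<chi> i j. cnj (A $ j $ i))"

lemma inner_eq_Re_trace:
  fixes A B :: "complex^'n^'m"
  shows "A \<bullet> B = Re (trace (ctranspose B ** A))"
proof -
  have "A \<bullet> B = (\<Sum>i\<in>UNIV. \<Sum>j\<in>UNIV. Re (cnj (B $ i $ j) * A $ i $ j))"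
    by (simp add: inner_vec_def inner_complex_def algebra_simps)
  also have "\<dots> = (\<Sum>j\<in>UNIV. \<Sum>i\<in>UNIV. Re (cnj (B $ i $ j) * A $ i $ j))"
    by (rule sum.swap)
  also have "\<dots> = Re (trace (ctranspose B ** A))"
    unfolding trace_def matrix_matrix_mult_def ctranspose_def by simp
  finally show ?thesis .
qed

lemma norm_eq_Frobenius:
  fixes A :: "complex^'n^'m"
  shows "norm A = sqrt (\<Sum>i\<in>UNIV. \<Sum>j\<in>UNIV. (cmod (A $ i $ j))\<^sup>2)"
  by (simp add: norm_vec_def L2_set_def sum_nonneg)


section \<open>Singular values\<close>

definition charpoly :: "complex^'n^'n \<Rightarrow> complex poly" where
  "charpoly M = det ((\<chi> i j. (if i = j then [:0, 1:] else 0) - [:M $ i $ j:]) :: complex poly^'n^'n)"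

text \<open>
  The square roots of the eigenvalues of \<open>A\<^sup>* A\<close>, listed in nonincreasing order and repeated
  according to multiplicity. These eigenvalues are real and nonnegative, so that taking
  real parts loses nothing. The list has length \<open>n\<close>; the singular values of \<open>A\<close> are its first
  \<open>min m n\<close> entries, the others being \<open>0\<close>.
\<close>

definition singular_value_list :: "complex^'n^'m \<Rightarrow> real list" where
  "singular_value_list A =
     rev (sorted_list_of_multiset
       (image_mset (\<lambda>z. sqrt (Re z)) (proots (charpoly (ctranspose A ** A)))))"

text \<open>Indexed from \<open>1\<close>; only meaningful for \<open>1 \<le> j \<le> min m n\<close>.\<close>

definition singular_value :: "complex^'n^'m \<Rightarrow> nat \<Rightarrow> real" where
  "singular_value A j = singular_value_list A ! (j - 1)"


section \<open>Fenchel conjugates and convex envelopes of extended-real-valued functions\<close>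

definition fenchel_conjugate :: "('a::real_inner \<Rightarrow> ereal) \<Rightarrow> 'a \<Rightarrow> ereal" where
  "fenchel_conjugate f B = (SUP A. ereal (A \<bullet> B) - f A)"

text \<open>Convexity of the epigraph, which avoids expressions of the form \<open>\<infinity> - \<infinity>\<close>.\<close>

definition convex_ereal :: "('a::real_vector \<Rightarrow> ereal) \<Rightarrow> bool" where
  "convex_ereal f \<longleftrightarrow> convex {(x, r :: real). f x \<le> ereal r}"

definition is_convex_envelope :: "('a::real_vector \<Rightarrow> ereal) \<Rightarrow> ('a \<Rightarrow> ereal) \<Rightarrow> bool" where
  "is_convex_envelope f g \<longleftrightarrow>
     convex_ereal g \<and> g \<le> f \<and> (\<forall>h. convex_ereal h \<and> h \<le> f \<longrightarrow> h \<le> g)"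


section \<open>The functional and the index \<open>k\<^sub>*\<close>\<close>

definition rank_indicator :: "nat \<Rightarrow> complex^'n^'m \<Rightarrow> ereal" where
  "rank_indicator K A = (if rank A \<le> K then 0 else \<infinity>)"

definition rank_functional :: "nat \<Rightarrow> complex^'n^'m \<Rightarrow> complex^'n^'m \<Rightarrow> ereal" where
  "rank_functional K F A = rank_indicator K A + ereal ((norm (A - F))\<^sup>2)"

text \<open>A sequence \<open>\<alpha>\<^sub>1, \<dots>, \<alpha>\<^sub>N\<close> extended by \<open>\<alpha>\<^sub>0 = \<infinity>\<close>.\<close>

definition extend_zero :: "(nat \<Rightarrow> real) \<Rightarrow> nat \<Rightarrow> ereal" where
  "extend_zero \<alpha> j = (if j = 0 then \<infinity> else ereal (\<alpha> j))"

definition is_k_star :: "nat \<Rightarrow> nat \<Rightarrow> (nat \<Rightarrow> real) \<Rightarrow> nat \<Rightarrow> bool" where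
  "is_k_star N K \<alpha> k \<longleftrightarrow>
     1 \<le> k \<and> k \<le> K \<and>
     \<alpha> (K - k + 1) \<le> (\<Sum>j = K - k + 1..N. \<alpha> j) / real k \<and>
     ereal ((\<Sum>j = K - k + 1..N. \<alpha> j) / real k) < extend_zero \<alpha> (K - k)"

definition k_star :: "nat \<Rightarrow> nat \<Rightarrow> (nat \<Rightarrow> real) \<Rightarrow> nat" where
  "k_star N K \<alpha> = (THE k. is_k_star N K \<alpha> k)"

lemma ex1_k_star:
  fixes \<alpha> :: "nat \<Rightarrow> real"
  assumes K: "1 \<le> K" "K < N"
    and mono: "\<And>i j. 1 \<le> i \<Longrightarrow> i \<le> j \<Longrightarrow> j \<le> N \<Longrightarrow> \<alpha> j \<le> \<alpha> i"
    and nonneg: "\<And>j. 1 \<le> j \<Longrightarrow> j \<le> N \<Longrightarrow> 0 \<le> \<alpha> j"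
  shows "\<exists>!k. is_k_star N K \<alpha> k"
proof -
  define s where "s k = (\<Sum>j = K - k + 1..N. \<alpha> j)" for k
  define P where "P k \<longleftrightarrow> k = K \<or> s k < real k * \<alpha> (K - k)" for k
  have s_Suc: "s (Suc k) = \<alpha> (K - k) + s k" if "k < K" for k
  proof -
    have "{K - Suc k + 1..N} = insert (K - k) {K - k + 1..N}"
      using that K by auto
    then show ?thesis unfolding s_def by simp
  qed
  have P_mono: "P k'" if "P k" "1 \<le> k" "k \<le> k'" "k' \<le> K" for k k'
    using that(3,4)
  proof (induction k' rule: dec_induct)
    case base
    then show ?case using that(1) by simp
  next
    case (step i)
    then have "s i < real i * \<alpha> (K - i)" by (auto simp: P_def)
    then have less: "s (Suc i) < real (Suc i) * \<alpha> (K - i)"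
      using s_Suc[of i] step by (simp add: algebra_simps)
    show ?case
    proof (cases "Suc i = K")
      case False
      have "\<alpha> (K - i) \<le> \<alpha> (K - Suc i)"
        using step False K by (intro mono) auto
      then have "real (Suc i) * \<alpha> (K - i) \<le> real (Suc i) * \<alpha> (K - Suc i)"
        by (rule mult_left_mono) simp
      then show ?thesis using less unfolding P_def by linarith
    qed (simp add: P_def)
  qed
  have Q_iff: "\<alpha> (K - k + 1) \<le> s k / real k \<longleftrightarrow> k = 1 \<or> \<not> P (k - 1)"
    if k: "1 \<le> k" "k \<le> K" for k
  proof (cases "k = 1")
    case True
    have "s 0 \<ge> 0" unfolding s_def using nonneg K by (intro sum_nonneg) auto
    then show ?thesis using True s_Suc[of 0] K by simp
  next
    case False
    then obtain i where i: "k = Suc i" "1 \<le> i" "i < K" using k by (cases k) auto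
    then have "K - k + 1 = K - i" by simp
    then show ?thesis using i s_Suc[of i] by (simp add: P_def field_simps not_less)
  qed
  have R_iff: "ereal (s k / real k) < extend_zero \<alpha> (K - k) \<longleftrightarrow> P k"
    if "1 \<le> k" "k \<le> K" for k
    using that by (auto simp: P_def extend_zero_def field_simps)
  have eq: "is_k_star N K \<alpha> k \<longleftrightarrow> 1 \<le> k \<and> k \<le> K \<and> (k = 1 \<or> \<not> P (k - 1)) \<and> P k" for k
    using Q_iff[of k] R_iff[of k] unfolding is_k_star_def s_def by auto
  define k where "k = (LEAST k. 1 \<le> k \<and> P k)"
  have ex: "1 \<le> K \<and> P K" using K by (simp add: P_def)
  have k: "1 \<le> k \<and> P k" unfolding k_def by (rule LeastI[where P = "\<lambda>k. 1 \<le> k \<and> P k", OF ex])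
  have le: "k \<le> i" if "1 \<le> i" "P i" for i
    unfolding k_def using that by (intro Least_le) auto
  show ?thesis
  proof (rule ex1I)
    show "is_k_star N K \<alpha> k"
      unfolding eq using k le[of "k - 1"] le[of K] ex by fastforce
  next
    fix i assume i: "is_k_star N K \<alpha> i"
    then have "k \<le> i" using le by (auto simp: eq)
    moreover have "\<not> k < i"
    proof
      assume "k < i"
      then have "k \<le> i - 1" "i - 1 \<le> K" "i \<noteq> 1" using i k by (auto simp: eq)
      then show False using i k P_mono[of k "i - 1"] by (simp add: eq)
    qed
    ultimately show "i = k" by simp
  qed
qed

end

theory Submission
  imports Defs
begin

text \<open>
  Write \<open>f\<close> for the rank functional. The biconjugate of \<open>f\<close> is convex and below \<open>f\<close>, being a supremum of
  affine minorants. It is therefore enough to prove, for every matrix \<open>A\<close> and with \<open>val A\<close> denoting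
  the claimed value, that each convex \<open>g \<le> f\<close> satisfies \<open>g A \<le> val A\<close>, and that the biconjugate is
  at least \<open>val A\<close>. The first bound, applied to the biconjugate itself, then gives equality, and
  applied to all other convex minorants it gives maximality.

  Both bounds start from a singular value decomposition \<open>A = (\<Sum>j. \<alpha> j *\<^sub>R E j)\<close> with
  matrices \<open>E j\<close> of rank at most one. Let \<open>k\<close> be the index \<open>k\<^sub>*\<close>, call the positions up to \<open>K - k\<close> the head and the
  others the tail, and let \<open>s\<close> be \<open>1 / k\<close> times the sum of the tail.

  For the first bound, the choice of \<open>k\<close> makes every tail entry at most \<open>s\<close>. Hence the tail lies
  in a scaled hypersimplex and is a convex combination of vectors that equal \<open>s\<close> on \<open>k\<close> positions and
  vanish elsewhere (lemma \<open>balanced_sum_in_convex_hull\<close>). Joining the head to each of these writes \<open>A\<close>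
  as a convex combination of matrices of rank at most \<open>K\<close> whose squared norms are at most
  \<open>V\<close>, the sum of the squared head plus \<open>k * s\<^sup>2\<close>; convexity of \<open>g\<close> yields the bound.

  For the second bound, flatten the tail to \<open>s\<close>: put \<open>Y = (\<Sum>j. c j *\<^sub>R E j)\<close>, where \<open>c\<close> is \<open>\<alpha>\<close> on
  the head and \<open>s\<close> on the tail. The other condition on \<open>k\<close> makes \<open>c\<close> nonincreasing, so that
  \<open>2 * (B \<bullet> Y) - (norm B)\<^sup>2\<close> is at most the sum of the first \<open>K\<close> squares of \<open>c\<close>, which is \<open>V\<close>, for all
  \<open>B\<close> of rank at most \<open>K\<close> (lemma \<open>eckart_young_bound\<close>), while \<open>A \<bullet> Y = V\<close>. The affine minorant of
  \<open>f\<close> with slope \<open>2 *\<^sub>R (Y - F)\<close> therefore reaches \<open>val A\<close> at \<open>A\<close>.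

  The singular values are defined through the characteristic polynomial of \<open>A\<^sup>* A\<close>; the lemma
  \<open>singular_value_decomposition\<close> links them to an orthonormal eigenbasis, which is built one vector at
  a time by maximising the quadratic form on the orthogonal complement of the vectors found so far.
\<close>

section \<open>Weighted sums and their largest terms\<close>

lemma exists_subset_of_largest:
  fixes y :: "'i \<Rightarrow> real"
  assumes "finite T" "k \<le> card T"
  shows "\<exists>I\<subseteq>T. card I = k \<and> (\<forall>i\<in>I. \<forall>j\<in>T - I. y j \<le> y i)"
  using assms(2)
proof (induction k)
  case (Suc k)
  then obtain I where I: "I \<subseteq> T" "card I = k" "\<forall>i\<in>I. \<forall>j\<in>T - I. y j \<le> y i" by auto
  have "T - I \<noteq> {}" using I(1,2) Suc.prems by auto
  then have "Max (y ` (T - I)) \<in> y ` (T - I)" using assms(1) by (intro Max_in) auto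
  then obtain m where "m \<in> T - I" "y m = Max (y ` (T - I))" by auto
  then have m: "m \<in> T - I" "\<And>j. j \<in> T - I \<Longrightarrow> y j \<le> y m" using assms(1) by auto
  have "finite I" using I(1) assms(1) by (rule finite_subset)
  then show ?case using I m by (intro exI[of _ "insert m I"]) auto
qed auto

text \<open>
  Shift \<open>y\<close> by the threshold \<open>\<theta>\<close>: then every term outside \<open>I\<close> is nonpositive and every term
  inside is largest at full weight \<open>s\<close>. The last hypothesis pays for the shift; it is an equality
  when the total weight is exactly \<open>s * card I\<close>, and for \<open>\<theta> \<ge> 0\<close> an upper bound on the total
  weight suffices.
\<close>

lemma weighted_sum_le_threshold:
  fixes t y :: "'i \<Rightarrow> real"
  assumes fin: "finite T" and I: "I \<subseteq> T"
    and t: "\<And>j. j \<in> T \<Longrightarrow> 0 \<le> t j \<and> t j \<le> s"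
    and above: "\<And>j. j \<in> I \<Longrightarrow> \<theta> \<le> y j" and below: "\<And>j. j \<in> T - I \<Longrightarrow> y j \<le> \<theta>"
    and total: "\<theta> * sum t T \<le> \<theta> * (s * real (card I))"
  shows "(\<Sum>j\<in>T. t j * y j) \<le> (\<Sum>j\<in>I. s * y j)"
proof -
  have "(\<Sum>j\<in>T. t j * (y j - \<theta>)) \<le> (\<Sum>j\<in>T. if j \<in> I then s * (y j - \<theta>) else 0)"
  proof (rule sum_mono)
    fix j assume j: "j \<in> T"
    show "t j * (y j - \<theta>) \<le> (if j \<in> I then s * (y j - \<theta>) else 0)"
      using t[OF j] above[of j] below[of j] j
      by (auto intro: mult_right_mono mult_nonneg_nonpos)
  qed
  also have "\<dots> = (\<Sum>j\<in>I. s * (y j - \<theta>))"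
    using fin I by (simp add: sum.inter_restrict[symmetric] Int_absorb1)
  finally have "(\<Sum>j\<in>T. t j * y j) - \<theta> * sum t T \<le> (\<Sum>j\<in>I. s * y j) - \<theta> * (s * real (card I))"
    by (simp add: right_diff_distrib sum_subtractf sum_distrib_left mult_ac)
  then show ?thesis using total by simp
qed

text \<open>
  The vectors with entries in \<open>[0, s]\<close> and entry sum \<open>s * k\<close> form a scaled hypersimplex, whose
  vertices are \<open>s\<close> times the indicators of the \<open>k\<close>-element sets; the statement is the image of
  this fact under a linear map. If the point were outside, a separating functional would contradict
  the fact that such a weighted sum is maximal when all weight is on the \<open>k\<close> largest values.
\<close>

lemma balanced_sum_in_convex_hull:
  fixes e :: "'i \<Rightarrow> 'a::euclidean_space" and b :: "'i \<Rightarrow> real"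
  assumes fin: "finite T" and k: "k \<le> card T"
    and b: "\<And>j. j \<in> T \<Longrightarrow> 0 \<le> b j \<and> b j \<le> s" and total: "sum b T = s * real k"
  shows "(\<Sum>j\<in>T. b j *\<^sub>R e j) \<in> convex hull ((\<lambda>I. \<Sum>j\<in>I. s *\<^sub>R e j) ` {I. I \<subseteq> T \<and> card I = k})"
    (is "?x \<in> convex hull ?S")
proof (rule ccontr)
  assume "?x \<notin> convex hull ?S"
  moreover have "closed (convex hull ?S)"
    using fin by (intro compact_imp_closed compact_convex_hull finite_imp_compact finite_imageI) simp
  ultimately obtain a d where a: "a \<bullet> ?x < d" "\<And>x. x \<in> convex hull ?S \<Longrightarrow> a \<bullet> x > d"
    using separating_hyperplane_closed_point[OF convex_convex_hull] by blast
  \<comment> \<open>The separation puts \<open>?x\<close> on the lower side, so the sign turns minimising into maximising.\<close>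
  define y where "y j = - (a \<bullet> e j)" for j
  obtain I where I: "I \<subseteq> T" "card I = k" "\<And>i j. i \<in> I \<Longrightarrow> j \<in> T - I \<Longrightarrow> y j \<le> y i"
    using exists_subset_of_largest[OF fin k, of y] by blast
  have finI: "finite I" using I(1) fin by (rule finite_subset)
  obtain \<theta> where \<theta>: "\<And>j. j \<in> I \<Longrightarrow> \<theta> \<le> y j" "\<And>j. j \<in> T - I \<Longrightarrow> y j \<le> \<theta>"
  proof (cases "I = {}")
    case True
    \<comment> \<open>The inserted \<open>0\<close> keeps the maximum defined for empty \<open>T\<close>.\<close>
    show thesis
      by (rule that[of "Max (insert 0 (y ` T))"]) (use True fin in auto)
  next
    case False
    show thesis
    proof (rule that[of "Min (y ` I)"])
      show "Min (y ` I) \<le> y j" if "j \<in> I" for j using that finI by simp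
      show "y j \<le> Min (y ` I)" if "j \<in> T - I" for j using that finI False I(3) by simp
    qed
  qed
  have "(\<Sum>j\<in>T. b j * y j) \<le> (\<Sum>j\<in>I. s * y j)"
    using \<theta> b I(1,2) total by (intro weighted_sum_le_threshold[OF fin]) auto
  then have "a \<bullet> (\<Sum>j\<in>I. s *\<^sub>R e j) \<le> a \<bullet> ?x"
    by (simp add: y_def inner_sum_right sum_negf)
  moreover have "(\<Sum>j\<in>I. s *\<^sub>R e j) \<in> convex hull ?S"
    using I(1,2) by (intro hull_inc) auto
  ultimately show False using a by fastforce
qed

section \<open>The Hermitian inner product and orthogonal families\<close>

definition cinner :: "complex^'n \<Rightarrow> complex^'n \<Rightarrow> complex" where
  "cinner x y = (\<Sum>i\<in>UNIV. cnj (x $ i) * y $ i)"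

lemma Re_cinner: "Re (cinner x y) = x \<bullet> y"
  by (simp add: cinner_def inner_vec_def inner_complex_def)

lemma cnj_cinner: "cnj (cinner x y) = cinner y x"
  by (simp add: cinner_def mult.commute)

lemma cinner_scale_right: "cinner x (c *s y) = c * cinner x y"
  by (simp add: cinner_def sum_distrib_left mult_ac)

lemma cinner_scale_left: "cinner (c *s x) y = cnj c * cinner x y"
  by (simp add: cinner_def sum_distrib_left mult_ac)

lemma Im_cinner: "Im (cinner x y) = (\<i> *s x) \<bullet> y"
  by (simp add: cinner_scale_left flip: Re_cinner)

lemma cinner_add_right: "cinner x (y + z) = cinner x y + cinner x z"
  by (simp add: cinner_def sum.distrib algebra_simps)

lemma cinner_same: "cinner x x = of_real ((norm x)\<^sup>2)"
proof (rule complex_eqI)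
  show "Re (cinner x x) = Re (of_real ((norm x)\<^sup>2))"
    by (simp add: Re_cinner power2_norm_eq_inner)
  show "Im (cinner x x) = Im (of_real ((norm x)\<^sup>2))"
    by (simp add: cinner_def mult.commute)
qed

lemma cinner_adjoint: "cinner x (A *v y) = cinner (ctranspose A *v x) y"
proof -
  have "cinner x (A *v y) = (\<Sum>i\<in>UNIV. \<Sum>j\<in>UNIV. cnj (x $ i) * A $ i $ j * y $ j)"
    by (simp add: cinner_def matrix_vector_mult_def sum_distrib_left mult.assoc)
  also have "\<dots> = (\<Sum>j\<in>UNIV. \<Sum>i\<in>UNIV. cnj (x $ i) * A $ i $ j * y $ j)"
    by (rule sum.swap)
  also have "\<dots> = cinner (ctranspose A *v x) y"
    by (simp add: cinner_def matrix_vector_mult_def ctranspose_def sum_distrib_left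
        sum_distrib_right mult_ac)
  finally show ?thesis .
qed

lemma norm_vector_scale: "norm (c *s (x :: complex^'n)) = cmod c * norm x"
proof -
  have "(norm (c *s x))\<^sup>2 = (cmod c * norm x)\<^sup>2"
    by (simp add: norm_vec_def L2_set_def sum_nonneg norm_mult power_mult_distrib sum_distrib_left)
  then show ?thesis by (simp add: power2_eq_iff_nonneg)
qed

lemma of_real_vector_scale: "of_real r *s (x :: complex^'n) = r *\<^sub>R x"
  by (simp add: vec_eq_iff scaleR_conv_of_real[where 'a = complex])

text \<open>
  Vectors shorter than a unit vector are admitted so that the left singular vectors belonging to
  the singular value \<open>0\<close> can be taken to be \<open>0\<close>.
\<close>

definition subunitary :: "'i set \<Rightarrow> ('i \<Rightarrow> complex^'n) \<Rightarrow> bool" where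
  "subunitary J u \<longleftrightarrow>
     (\<forall>j\<in>J. norm (u j) \<le> 1) \<and> (\<forall>i\<in>J. \<forall>j\<in>J. i \<noteq> j \<longrightarrow> cinner (u i) (u j) = 0)"

text \<open>
  Bessel's inequality survives the relaxation: the components \<open>p j\<close> of \<open>x\<close> along the \<open>u j\<close> are
  still orthogonal, and shortening \<open>u j\<close> only lowers \<open>norm (p j)\<close> relative to \<open>x \<bullet> p j\<close>.
\<close>

lemma bessel:
  assumes "finite J" "subunitary J u"
  shows "(\<Sum>j\<in>J. (cmod (cinner (u j) x))\<^sup>2) \<le> (norm x)\<^sup>2"
proof -
  define p where "p j = cinner (u j) x *s u j" for j
  have xp: "x \<bullet> p j = (cmod (cinner (u j) x))\<^sup>2" for j
  proof -
    have "cinner x (p j) = cinner (u j) x * cnj (cinner (u j) x)"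
      by (simp add: p_def cinner_scale_right cnj_cinner)
    then have "Re (cinner x (p j)) = (cmod (cinner (u j) x))\<^sup>2"
      by (simp only: complex_norm_square[symmetric] Re_complex_of_real)
    then show ?thesis by (simp add: Re_cinner)
  qed
  have orth: "pairwise (\<lambda>i j. orthogonal (p i) (p j)) J"
    using assms(2) unfolding pairwise_def orthogonal_def subunitary_def p_def
    by (auto simp: cinner_scale_left cinner_scale_right simp flip: Re_cinner)
  have np: "(norm (p j))\<^sup>2 \<le> (cmod (cinner (u j) x))\<^sup>2" if "j \<in> J" for j
  proof -
    have "norm (p j) \<le> cmod (cinner (u j) x) * 1"
      using assms(2) that unfolding p_def norm_vector_scale subunitary_def
      by (intro mult_left_mono) auto
    then show ?thesis by (simp add: power_mono)
  qed
  have "0 \<le> (norm (x - sum p J))\<^sup>2" by simp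
  also have "\<dots> = (norm x)\<^sup>2 - 2 * (\<Sum>j\<in>J. x \<bullet> p j) + (\<Sum>j\<in>J. (norm (p j))\<^sup>2)"
    unfolding norm_sum_Pythagorean[OF assms(1) orth, symmetric]
    by (simp add: power2_norm_eq_inner inner_diff inner_sum_right inner_commute)
  also have "\<dots> \<le> (norm x)\<^sup>2 - 2 * (\<Sum>j\<in>J. x \<bullet> p j) + (\<Sum>j\<in>J. x \<bullet> p j)"
    using np by (simp add: xp sum_mono)
  finally show ?thesis by (simp add: xp)
qed

text \<open>
  Sum Bessel's inequality over the standard basis and exchange the two sums.
\<close>

lemma card_orthonormal_le_dimension:
  fixes u :: "'i \<Rightarrow> complex^'n"
  assumes "finite J" "subunitary J u" "\<And>j. j \<in> J \<Longrightarrow> norm (u j) = 1"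
  shows "card J \<le> CARD('n)"
proof -
  have "(\<Sum>a\<in>UNIV. (cmod (cinner (u j) (axis a 1)))\<^sup>2) = 1" if "j \<in> J" for j
  proof -
    have "cinner (u j) (axis a 1) = cnj (u j $ a)" for a
      by (simp add: cinner_def axis_def if_distrib if_distribR cong: if_cong)
    moreover have "(norm (u j))\<^sup>2 = (\<Sum>a\<in>UNIV. (cmod (u j $ a))\<^sup>2)"
      by (simp add: norm_vec_def L2_set_def sum_nonneg)
    ultimately show ?thesis using assms(3)[OF that] by simp
  qed
  then have "real (card J) = (\<Sum>j\<in>J. \<Sum>a\<in>UNIV. (cmod (cinner (u j) (axis a 1)))\<^sup>2)"
    by simp
  also have "\<dots> = (\<Sum>a\<in>UNIV. \<Sum>j\<in>J. (cmod (cinner (u j) (axis a 1)))\<^sup>2)"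
    by (rule sum.swap)
  also have "\<dots> \<le> (\<Sum>a\<in>(UNIV::'n set). (norm (axis a (1::complex)))\<^sup>2)"
    by (intro sum_mono bessel assms)
  also have "\<dots> = real CARD('n)" by simp
  finally show ?thesis by simp
qed

section \<open>Sums of rank-one matrices and low-rank approximation\<close>

definition outer :: "complex^'m \<Rightarrow> complex^'n \<Rightarrow> complex^'n^'m" where
  "outer u w = (\<chi> a b. u $ a * w $ b)"

lemma inner_outer_outer:
  "outer u w \<bullet> outer u' w' = Re (cinner u u' * cinner w w')"
proof -
  have "outer u w \<bullet> outer u' w' =
      Re (\<Sum>a\<in>UNIV. \<Sum>b\<in>UNIV. (cnj (u $ a) * u' $ a) * (cnj (w $ b) * w' $ b))"
    by (simp add: inner_vec_def inner_complex_def outer_def algebra_simps)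
  then show ?thesis
    by (simp only: cinner_def sum_product)
qed

lemma rank_sum_outer_le:
  fixes w :: "'i \<Rightarrow> complex^'n" and u :: "'i \<Rightarrow> complex^'m"
  assumes "finite J" "J \<subseteq> I" "\<And>j. j \<in> I - J \<Longrightarrow> c j = 0"
  shows "rank (\<Sum>j\<in>I. c j *\<^sub>R outer (u j) (w j)) \<le> card J"
proof -
  have "row a (\<Sum>j\<in>I. c j *\<^sub>R outer (u j) (w j)) \<in> vec.span (w ` J)" for a
  proof -
    have "row a (\<Sum>j\<in>I. c j *\<^sub>R outer (u j) (w j)) =
        (\<Sum>j\<in>I. (of_real (c j) * u j $ a) *s w j)"
      by (simp add: row_def vec_eq_iff outer_def scaleR_conv_of_real[where 'a = complex] mult.assoc)
    moreover have "(of_real (c j) * u j $ a) *s w j \<in> vec.span (w ` J)" if "j \<in> I" for j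
      using assms(3)[of j] that
      by (cases "j \<in> J") (auto intro: vec.span_scale vec.span_base vec.span_zero)
    ultimately show ?thesis by (simp add: vec.span_sum)
  qed
  then have "rank (\<Sum>j\<in>I. c j *\<^sub>R outer (u j) (w j)) \<le> card (w ` J)"
    unfolding row_rank_def_gen using assms(1)
    by (intro vec.dim_le_card) (auto simp: rows_def)
  also have "\<dots> \<le> card J" using assms(1) by (rule card_image_le)
  finally show ?thesis .
qed

lemma inner_sum_outer:
  assumes "finite J" "subunitary J u" "subunitary J w"
  shows "(\<Sum>j\<in>J. a j *\<^sub>R outer (u j) (w j)) \<bullet> (\<Sum>j\<in>J. b j *\<^sub>R outer (u j) (w j)) =
    (\<Sum>j\<in>J. a j * b j * ((norm (u j))\<^sup>2 * (norm (w j))\<^sup>2))"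
proof -
  have inner: "outer (u i) (w i) \<bullet> outer (u j) (w j) =
      (if i = j then (norm (u i))\<^sup>2 * (norm (w i))\<^sup>2 else 0)"
    if "i \<in> J" "j \<in> J" for i j
    using assms(2) that by (auto simp: inner_outer_outer cinner_same subunitary_def)
  have "(\<Sum>j\<in>J. a j *\<^sub>R outer (u j) (w j)) \<bullet> (\<Sum>j\<in>J. b j *\<^sub>R outer (u j) (w j)) =
      (\<Sum>i\<in>J. a i * (\<Sum>j\<in>J. b j * (outer (u i) (w i) \<bullet> outer (u j) (w j))))"
    by (simp add: inner_sum_left inner_sum_right[of "outer _ _"])
  also have "\<dots> = (\<Sum>i\<in>J. a i * (\<Sum>j\<in>J. if i = j then b i * ((norm (u i))\<^sup>2 * (norm (w i))\<^sup>2) else 0))"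
    by (intro sum.cong arg_cong2[where f = "(*)"] refl) (simp add: inner)
  also have "\<dots> = (\<Sum>j\<in>J. a j * b j * ((norm (u j))\<^sup>2 * (norm (w j))\<^sup>2))"
    using assms(1) by (simp add: mult.assoc)
  finally show ?thesis .
qed

lemma norm_sum_outer_le:
  assumes "finite J" "subunitary J u" "subunitary J w"
  shows "(norm (\<Sum>j\<in>J. a j *\<^sub>R outer (u j) (w j)))\<^sup>2 \<le> (\<Sum>j\<in>J. (a j)\<^sup>2)"
  unfolding power2_norm_eq_inner[of "sum _ _"] inner_sum_outer[OF assms]
proof (rule sum_mono)
  fix j assume "j \<in> J"
  then have "(norm (u j))\<^sup>2 * (norm (w j))\<^sup>2 \<le> 1 * 1"
    using assms(2,3) by (intro mult_mono power_le_one) (auto simp: subunitary_def)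
  then have "(a j)\<^sup>2 * ((norm (u j))\<^sup>2 * (norm (w j))\<^sup>2) \<le> (a j)\<^sup>2 * 1"
    by (intro mult_left_mono) auto
  then show "a j * a j * ((norm (u j))\<^sup>2 * (norm (w j))\<^sup>2) \<le> (a j)\<^sup>2"
    by (simp add: power2_eq_square)
qed

lemma subunitary_subset: "subunitary J u \<Longrightarrow> I \<subseteq> J \<Longrightarrow> subunitary I u"
  by (auto simp: subunitary_def subset_iff)

text \<open>
  The rank counts complex dimensions, whereas orthonormal bases are available for real subspaces.
  The row space, regarded as a real subspace, is spanned by a complex basis together with its
  multiples by \<open>\<i>\<close>, whence the factor \<open>2\<close>.
\<close>

lemma real_basis_of_row_space:
  fixes B :: "complex^'n^'m"
  obtains R where "finite R" "card R \<le> 2 * rank B"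
    "\<And>i j. i \<in> R \<Longrightarrow> j \<in> R \<Longrightarrow> i \<bullet> j = (if i = j then 1 else 0)"
    "\<And>x y. x \<in> vec.span (rows B) \<Longrightarrow> x \<bullet> y = (\<Sum>b\<in>R. (b \<bullet> x) * (b \<bullet> y))"
proof -
  define W where "W = vec.span (rows B)"
  obtain C where C: "C \<subseteq> W" "vec.independent C" "W \<subseteq> vec.span C" "card C = vec.dim W"
    using vec.basis_exists by metis
  have finC: "finite C" using C(2) by (rule vec.finiteI_independent)
  have cardC: "card C = rank B" using C(4) by (simp add: W_def row_rank_def_gen)
  define D where "D = C \<union> (\<lambda>x. \<i> *s x) ` C"
  have "subspace W"
    unfolding subspace_def W_def
    by (auto intro: vec.span_zero vec.span_add vec.span_scale simp flip: of_real_vector_scale)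
  moreover have "W \<subseteq> span D"
  proof
    fix x assume "x \<in> W"
    then obtain q where "x = (\<Sum>c\<in>C. q c *s c)"
      using C(3) finC by (force simp: vec.span_finite)
    moreover have "q c *s c \<in> span D" if "c \<in> C" for c
    proof -
      have "q c *s c = of_real (Re (q c)) *s c + of_real (Im (q c)) *s (\<i> *s c)"
        by (simp add: vec_eq_iff complex_eq_iff)
      then have "q c *s c = Re (q c) *\<^sub>R c + Im (q c) *\<^sub>R (\<i> *s c)"
        by (simp only: of_real_vector_scale)
      then show ?thesis
        using that by (auto simp: D_def intro!: span_add span_scale intro: span_base)
    qed
    ultimately show "x \<in> span D" by (simp add: span_sum)
  qed
  then have dimW: "dim W \<le> card D" using finC by (intro dim_le_card) (auto simp: D_def)
  have "card D \<le> card C + card C"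
    unfolding D_def by (metis card_Un_le card_image_le finC add_left_mono order_trans)
  obtain R where R: "R \<subseteq> W" "pairwise orthogonal R" "\<And>x. x \<in> R \<Longrightarrow> norm x = 1"
    "independent R" "card R = dim W" "span R = W"
    using orthonormal_basis_subspace[OF \<open>subspace W\<close>] by metis
  have finR: "finite R" using R(4) by (simp add: independent_imp_finite)
  show thesis
  proof
    show "finite R" by fact
    show "card R \<le> 2 * rank B"
      using dimW R(5) cardC \<open>card D \<le> card C + card C\<close> by simp
    show "i \<bullet> j = (if i = j then 1 else 0)" if "i \<in> R" "j \<in> R" for i j
      using R(2,3) that by (auto simp: pairwise_def orthogonal_def norm_eq_1)
    fix x y assume "x \<in> vec.span (rows B)"
    then have x: "(\<Sum>b\<in>R. (x \<bullet> b) *\<^sub>R b) = x"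
      using R(2,3,6) finR by (intro orthonormal_basis_expand) (auto simp: W_def)
    have "x \<bullet> y = (\<Sum>b\<in>R. (x \<bullet> b) *\<^sub>R b) \<bullet> y" by (simp only: x)
    then show "x \<bullet> y = (\<Sum>b\<in>R. (b \<bullet> x) * (b \<bullet> y))"
      by (simp add: inner_sum_left inner_sum_right inner_commute)
  qed
qed

lemma real_bessel:
  fixes w :: "'a::real_inner"
  assumes "finite R" "\<And>i j. i \<in> R \<Longrightarrow> j \<in> R \<Longrightarrow> i \<bullet> j = (if i = j then 1 else 0)"
  shows "(\<Sum>b\<in>R. (b \<bullet> w)\<^sup>2) \<le> (norm w)\<^sup>2"
proof -
  define p where "p = (\<Sum>b\<in>R. (b \<bullet> w) *\<^sub>R b)"
  have wp: "w \<bullet> p = (\<Sum>b\<in>R. (b \<bullet> w)\<^sup>2)"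
    by (simp add: p_def inner_sum_right power2_eq_square inner_commute)
  have "p \<bullet> p = (\<Sum>i\<in>R. \<Sum>j\<in>R. (i \<bullet> w) * ((j \<bullet> w) * (i \<bullet> j)))"
    by (simp add: p_def inner_sum_left inner_sum_right sum_distrib_left mult_ac inner_commute)
  also have "\<dots> = (\<Sum>i\<in>R. \<Sum>j\<in>R. if i = j then (i \<bullet> w)\<^sup>2 else 0)"
    by (intro sum.cong refl) (auto simp: assms(2) power2_eq_square)
  also have "\<dots> = (\<Sum>b\<in>R. (b \<bullet> w)\<^sup>2)" using assms(1) by simp
  finally have pp: "p \<bullet> p = (\<Sum>b\<in>R. (b \<bullet> w)\<^sup>2)" .
  have "0 \<le> (w - p) \<bullet> (w - p)" by simp
  then show ?thesis
    by (simp add: inner_diff wp pp inner_commute[of p w] power2_norm_eq_inner)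
qed

text \<open>
  This is the estimate behind the Eckart--Young theorem. Let \<open>P\<close> be the orthogonal projection
  onto the row space of \<open>B\<close> and \<open>t j = (norm (P (w j)))\<^sup>2\<close>. The vectors \<open>z j\<close> obtained by
  combining the rows of \<open>B\<close> with the coefficients \<open>cnj (u j)\<close> satisfy
  \<open>B \<bullet> outer (u j) (w j) = z j \<bullet> w j\<close>. They lie in the row space, so
  \<open>2 * c * (z \<bullet> w) - (norm z)\<^sup>2 \<le> c\<^sup>2 * (norm (P w))\<^sup>2\<close>, and by Bessel the squared norms of the \<open>z j\<close>
  add up to at most \<open>(norm B)\<^sup>2\<close>. The weights add up to at most the dimension of the row space, again
  by Bessel, now applied to an orthonormal basis of that space.
\<close>

lemma low_rank_weights:
  fixes B :: "complex^'n^'m"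
  assumes fin: "finite J" and u: "subunitary J u" and w: "subunitary J w" and rk: "rank B \<le> K"
  obtains t :: "'i \<Rightarrow> real" where
    "\<And>j. j \<in> J \<Longrightarrow> 0 \<le> t j \<and> t j \<le> 1" "sum t J \<le> real K"
    "\<And>c :: 'i \<Rightarrow> real. 2 * (B \<bullet> (\<Sum>j\<in>J. c j *\<^sub>R outer (u j) (w j))) - (norm B)\<^sup>2
       \<le> (\<Sum>j\<in>J. (c j)\<^sup>2 * t j)"
proof -
  define W where "W = vec.span (rows B)"
  obtain R where R: "finite R" "card R \<le> 2 * rank B"
    "\<And>i j. i \<in> R \<Longrightarrow> j \<in> R \<Longrightarrow> i \<bullet> j = (if i = j then 1 else 0)"
    "\<And>x y. x \<in> W \<Longrightarrow> x \<bullet> y = (\<Sum>b\<in>R. (b \<bullet> x) * (b \<bullet> y))"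
    unfolding W_def using real_basis_of_row_space[of B] by blast
  \<comment> \<open>Half, because \<open>R\<close> is a real basis and has two vectors for each complex dimension.\<close>
  define t where "t j = (\<Sum>b\<in>R. (cmod (cinner (w j) b))\<^sup>2) / 2" for j
  have t_eq: "2 * t j = (\<Sum>b\<in>R. (b \<bullet> w j)\<^sup>2) + (\<Sum>b\<in>R. (b \<bullet> (\<i> *s w j))\<^sup>2)" for j
    unfolding t_def
    by (simp add: cmod_power2 Re_cinner Im_cinner sum.distrib inner_commute)
  show thesis
  proof
    fix j assume j: "j \<in> J"
    have "norm (w j) \<le> 1" using w j by (auto simp: subunitary_def)
    then have "(norm (w j))\<^sup>2 \<le> 1" by (simp add: power_le_one)
    moreover have "(\<Sum>b\<in>R. (b \<bullet> w j)\<^sup>2) \<le> (norm (w j))\<^sup>2"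
      using R(1,3) by (rule real_bessel)
    moreover have "(\<Sum>b\<in>R. (b \<bullet> (\<i> *s w j))\<^sup>2) \<le> (norm (\<i> *s w j))\<^sup>2"
      using R(1,3) by (rule real_bessel)
    moreover have "norm (\<i> *s w j) = norm (w j)" by (simp add: norm_vector_scale)
    ultimately show "0 \<le> t j \<and> t j \<le> 1"
      using t_eq[of j] by (simp add: t_def sum_nonneg)
  next
    have "2 * sum t J = (\<Sum>j\<in>J. \<Sum>b\<in>R. (cmod (cinner (w j) b))\<^sup>2)"
      by (simp add: t_def flip: sum_divide_distrib)
    also have "\<dots> = (\<Sum>b\<in>R. \<Sum>j\<in>J. (cmod (cinner (w j) b))\<^sup>2)" by (rule sum.swap)
    also have "\<dots> \<le> (\<Sum>b\<in>R. (norm b)\<^sup>2)" by (intro sum_mono bessel fin w)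
    also have "\<dots> = real (card R)" using R(3) by (simp add: power2_norm_eq_inner)
    also have "\<dots> \<le> 2 * real K" using R(2) rk by simp
    finally show "sum t J \<le> real K" by simp
  next
    fix c :: "'i \<Rightarrow> real"
    define z where "z j = (\<Sum>a\<in>UNIV. cnj (u j $ a) *s row a B)" for j
    have z_nth: "z j $ b = cinner (u j) (column b B)" for j b
      by (simp add: z_def cinner_def column_def row_def)
    have zW: "z j \<in> W" for j
      unfolding z_def W_def
      by (intro vec.span_sum vec.span_scale vec.span_base) (auto simp: rows_def)
    have iW: "\<i> *s x \<in> W" if "x \<in> W" for x
      using that unfolding W_def by (rule vec.span_scale)
    have inner_z: "B \<bullet> outer (u j) (w j) = z j \<bullet> w j" for j
    proof -
      have "B \<bullet> outer (u j) (w j) =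
          Re (\<Sum>a\<in>UNIV. \<Sum>b\<in>UNIV. cnj (cnj (u j $ a) * B $ a $ b) * w j $ b)"
        by (simp add: inner_vec_def inner_complex_def outer_def algebra_simps)
      also have "\<dots> = Re (\<Sum>b\<in>UNIV. \<Sum>a\<in>UNIV. cnj (cnj (u j $ a) * B $ a $ b) * w j $ b)"
        by (subst sum.swap) simp
      also have "\<dots> = Re (cinner (z j) (w j))"
        by (simp add: cinner_def z_def row_def sum_distrib_right)
      finally show ?thesis by (simp add: Re_cinner)
    qed
    have norm_z: "(\<Sum>j\<in>J. (norm (z j))\<^sup>2) \<le> (norm B)\<^sup>2"
    proof -
      have "(\<Sum>j\<in>J. (norm (z j))\<^sup>2) = (\<Sum>j\<in>J. \<Sum>b\<in>UNIV. (cmod (cinner (u j) (column b B)))\<^sup>2)"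
        by (simp add: norm_vec_def L2_set_def sum_nonneg flip: z_nth)
      also have "\<dots> = (\<Sum>b\<in>UNIV. \<Sum>j\<in>J. (cmod (cinner (u j) (column b B)))\<^sup>2)"
        by (rule sum.swap)
      also have "\<dots> \<le> (\<Sum>b\<in>UNIV. (norm (column b B))\<^sup>2)" by (intro sum_mono bessel fin u)
      also have "\<dots> = (\<Sum>b\<in>UNIV. \<Sum>a\<in>UNIV. (cmod (B $ a $ b))\<^sup>2)"
        by (simp add: norm_vec_def L2_set_def sum_nonneg column_def)
      also have "\<dots> = (norm B)\<^sup>2"
        by (subst sum.swap) (simp add: norm_vec_def L2_set_def sum_nonneg)
      finally show ?thesis .
    qed
    have young: "2 * d * (x \<bullet> y) - (norm x)\<^sup>2 \<le> d\<^sup>2 * (\<Sum>b\<in>R. (b \<bullet> y)\<^sup>2)"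
      if "x \<in> W" for x y and d :: real
    proof -
      have "2 * d * (x \<bullet> y) - (norm x)\<^sup>2 = (\<Sum>b\<in>R. 2 * d * ((b \<bullet> x) * (b \<bullet> y)) - (b \<bullet> x)\<^sup>2)"
        unfolding power2_norm_eq_inner R(4)[OF that]
        by (simp add: sum_subtractf sum_distrib_left power2_eq_square)
      also have "\<dots> \<le> (\<Sum>b\<in>R. d\<^sup>2 * (b \<bullet> y)\<^sup>2)"
      proof (rule sum_mono)
        fix b
        have "0 \<le> (d * (b \<bullet> y) - b \<bullet> x)\<^sup>2" by simp
        then show "2 * d * ((b \<bullet> x) * (b \<bullet> y)) - (b \<bullet> x)\<^sup>2 \<le> d\<^sup>2 * (b \<bullet> y)\<^sup>2"
          by (simp add: power2_eq_square algebra_simps)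
      qed
      finally show ?thesis by (simp add: sum_distrib_left)
    qed
    \<comment> \<open>Averaging the estimate for \<open>z j, w j\<close> with the one for their multiples by \<open>\<i>\<close> replaces real
      squares by squared moduli, and so produces the weight \<open>t j\<close>.\<close>
    have bound: "2 * c j * (z j \<bullet> w j) - (norm (z j))\<^sup>2 \<le> (c j)\<^sup>2 * t j" for j
    proof -
      have "(\<i> *s z j) \<bullet> (\<i> *s w j) = z j \<bullet> w j"
        by (simp add: cinner_scale_left cinner_scale_right flip: Re_cinner)
      then have "2 * (2 * c j * (z j \<bullet> w j) - (norm (z j))\<^sup>2) \<le> (c j)\<^sup>2 * (2 * t j)"
        using young[OF zW[of j], of "c j" "w j"]
          young[OF iW[OF zW[of j]], of "c j" "\<i> *s w j"]
        unfolding t_eq by (simp add: norm_vector_scale algebra_simps)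
      then show ?thesis by simp
    qed
    have "2 * (B \<bullet> (\<Sum>j\<in>J. c j *\<^sub>R outer (u j) (w j))) - (norm B)\<^sup>2 \<le>
        (\<Sum>j\<in>J. 2 * c j * (z j \<bullet> w j)) - (\<Sum>j\<in>J. (norm (z j))\<^sup>2)"
      using norm_z by (simp add: inner_sum_right inner_z sum_distrib_left mult.assoc)
    also have "\<dots> \<le> (\<Sum>j\<in>J. (c j)\<^sup>2 * t j)"
      unfolding sum_subtractf[symmetric] by (intro sum_mono bound)
    finally show "2 * (B \<bullet> (\<Sum>j\<in>J. c j *\<^sub>R outer (u j) (w j))) - (norm B)\<^sup>2
       \<le> (\<Sum>j\<in>J. (c j)\<^sup>2 * t j)" .
  qed
qed

text \<open>
  By \<open>low_rank_weights\<close> the left-hand side is at most a sum of the \<open>(c j)\<^sup>2\<close> with weights in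
  \<open>[0, 1]\<close> of total weight at most \<open>K\<close>; this is largest when the \<open>K\<close> largest terms carry all the weight.
\<close>

lemma eckart_young_bound:
  fixes B :: "complex^'n^'m" and c :: "nat \<Rightarrow> real"
  assumes u: "subunitary {1..N} u" and w: "subunitary {1..N} w"
    and K: "1 \<le> K" "K \<le> N" and rk: "rank B \<le> K"
    and mono: "\<And>i j. 1 \<le> i \<Longrightarrow> i \<le> j \<Longrightarrow> j \<le> N \<Longrightarrow> c j \<le> c i"
    and nonneg: "\<And>j. 1 \<le> j \<Longrightarrow> j \<le> N \<Longrightarrow> 0 \<le> c j"
  shows "2 * (B \<bullet> (\<Sum>j=1..N. c j *\<^sub>R outer (u j) (w j))) - (norm B)\<^sup>2 \<le> (\<Sum>j=1..K. (c j)\<^sup>2)"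
proof -
  obtain t :: "nat \<Rightarrow> real" where t: "\<And>j. j \<in> {1..N} \<Longrightarrow> 0 \<le> t j \<and> t j \<le> 1" "sum t {1..N} \<le> real K"
    "\<And>c :: nat \<Rightarrow> real. 2 * (B \<bullet> (\<Sum>j=1..N. c j *\<^sub>R outer (u j) (w j))) - (norm B)\<^sup>2
       \<le> (\<Sum>j=1..N. (c j)\<^sup>2 * t j)"
    by (rule low_rank_weights[OF finite_atLeastAtMost u w rk]) blast
  have "(\<Sum>j=1..N. t j * (c j)\<^sup>2) \<le> (\<Sum>j=1..K. 1 * (c j)\<^sup>2)"
  proof (rule weighted_sum_le_threshold[where \<theta> = "(c K)\<^sup>2"])
    show "(c K)\<^sup>2 \<le> (c j)\<^sup>2" if "j \<in> {1..K}" for j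
      using that K mono nonneg by (intro power_mono) auto
    show "(c j)\<^sup>2 \<le> (c K)\<^sup>2" if "j \<in> {1..N} - {1..K}" for j
      using that K mono nonneg by (intro power_mono) auto
    show "(c K)\<^sup>2 * sum t {1..N} \<le> (c K)\<^sup>2 * (1 * real (card {1..K}))"
      using t(2) by (intro mult_left_mono) auto
  qed (use t(1) K in auto)
  then show ?thesis using t(3)[of c] by (simp add: mult.commute)
qed

section \<open>The spectral theorem for Hermitian matrices\<close>

lemma zero_if_quadratic_nonpos:
  fixes a b :: real
  assumes "\<And>t. 2 * t * a + t\<^sup>2 * b \<le> 0"
  shows "a = 0"
proof (rule ccontr)
  assume "a \<noteq> 0"
  \<comment> \<open>Any denominator \<open>d > 0\<close> with \<open>2 * d + b > 0\<close> gives a violating \<open>t = a / d\<close>.\<close>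
  define d where "d = 1 + \<bar>b\<bar>"
  have d: "d > 0" "2 * d + b > 0" by (auto simp: d_def)
  have "2 * (a / d) * a + (a / d)\<^sup>2 * b = (a / d)\<^sup>2 * (2 * d + b)"
    using d(1) by (simp add: power2_eq_square field_simps)
  moreover have "0 < (a / d)\<^sup>2 * (2 * d + b)"
    using \<open>a \<noteq> 0\<close> d by simp
  ultimately show False using assms[of "a / d"] by simp
qed

lemma hermitian_form_real_symmetric:
  assumes "ctranspose H = H"
  shows "x \<bullet> (H *v y) = (H *v x) \<bullet> y"
  using cinner_adjoint[of x H y] assms by (metis Re_cinner)

text \<open>
  Hermitian orthogonality to \<open>y\<close> is real orthogonality to \<open>y\<close> and \<open>\<i> *s y\<close>, and these
  \<open>2 * card S\<close> vectors do not span the real space of dimension \<open>2 * CARD('n)\<close>.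
\<close>

lemma exists_orthogonal_vector:
  fixes S :: "(complex^'n) set"
  assumes "finite S" "card S < CARD('n)"
  obtains x where "x \<noteq> 0" "\<And>y. y \<in> S \<Longrightarrow> cinner y x = 0"
proof -
  define D where "D = S \<union> (\<lambda>x. \<i> *s x) ` S"
  have "card D \<le> card S + card S"
    unfolding D_def by (metis card_Un_le card_image_le assms(1) add_left_mono order_trans)
  moreover have "dim D \<le> card D"
    using assms(1) by (intro dim_le_card') (auto simp: D_def)
  moreover have "DIM(complex^'n) = 2 * CARD('n)" by simp
  ultimately have "dim D < DIM(complex^'n)" using assms(2) by linarith
  then obtain x where x: "x \<noteq> 0" "\<And>y. y \<in> span D \<Longrightarrow> orthogonal x y"
    using orthogonal_to_subspace_exists by metis
  show thesis
  proof
    fix y assume "y \<in> S"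
    then have "orthogonal x y" "orthogonal x (\<i> *s y)"
      by (auto intro!: x(2) span_base simp: D_def)
    then show "cinner y x = 0"
      by (simp add: complex_eq_iff Re_cinner Im_cinner orthogonal_def inner_commute)
  qed (rule x(1))
qed

definition orthonormal_eigenvectors :: "complex^'n^'n \<Rightarrow> (complex^'n) set \<Rightarrow> bool" where
  "orthonormal_eigenvectors H S \<longleftrightarrow> finite S \<and>
     (\<forall>x\<in>S. norm x = 1 \<and> (\<exists>l :: real. H *v x = of_real l *s x)) \<and>
     (\<forall>x\<in>S. \<forall>y\<in>S. x \<noteq> y \<longrightarrow> cinner x y = 0)"

text \<open>
  The orthogonal complement \<open>U\<close> of \<open>S\<close> is nonzero and mapped to itself by \<open>H\<close>. The quadratic form
  \<open>x \<bullet> (H *v x)\<close> attains a maximum \<open>l\<close> on the unit sphere of \<open>U\<close>, at \<open>v\<close> say. Then \<open>l * (y \<bullet> y)\<close>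
  dominates the form on \<open>U\<close>, and expanding along \<open>v + t *\<^sub>R z\<close> with \<open>z = H *v v - l *\<^sub>R v\<close>, which lies in
  \<open>U\<close>, shows that the first-order term \<open>z \<bullet> z\<close> vanishes.
\<close>

lemma extend_orthonormal_eigenvectors:
  fixes H :: "complex^'n^'n"
  assumes H: "ctranspose H = H" and S: "orthonormal_eigenvectors H S" "card S < CARD('n)"
  obtains v where "v \<notin> S" "orthonormal_eigenvectors H (insert v S)"
proof -
  have finS: "finite S" using S by (simp add: orthonormal_eigenvectors_def)
  define U where "U = {x. \<forall>y\<in>S. cinner y x = 0}"
  have scaleR_eq: "r *\<^sub>R x = of_real r *s x" for r and x :: "complex^'n"
    by (simp add: of_real_vector_scale)
  have subU: "subspace U"
    unfolding subspace_def U_def by (simp add: scaleR_eq cinner_add_right cinner_scale_right)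
      (simp add: cinner_def)
  have HU: "H *v x \<in> U" if "x \<in> U" for x
    unfolding U_def
  proof safe
    fix y assume y: "y \<in> S"
    then have "\<exists>l :: real. H *v y = of_real l *s y"
      using S(1) by (simp add: orthonormal_eigenvectors_def)
    then obtain l :: real where "H *v y = of_real l *s y" ..
    then show "cinner y (H *v x) = 0"
      using that y by (simp add: cinner_adjoint[of y H x] H cinner_scale_left U_def)
  qed
  obtain x0 where "x0 \<noteq> 0" "\<And>y. y \<in> S \<Longrightarrow> cinner y x0 = 0"
    using exists_orthogonal_vector[OF finS S(2)] by metis
  then have x0: "x0 \<noteq> 0" "x0 \<in> U" by (simp_all add: U_def)
  define q where "q x = x \<bullet> (H *v x)" for x
  have lin: "linear ((*v) H)"
  proof (rule linearI)
    show "H *v (x + y) = H *v x + H *v y" for x y by (simp add: matrix_vector_right_distrib)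
    show "H *v (r *\<^sub>R x) = r *\<^sub>R (H *v x)" for r x
      unfolding scaleR_eq by (simp add: vector_scalar_commute)
  qed
  have "compact (U \<inter> sphere 0 1)"
    using closed_subspace[OF subU] by (simp add: closed_Int_compact)
  moreover have "x0 /\<^sub>R norm x0 \<in> U \<inter> sphere 0 1"
    using x0 subU by (simp add: subspace_scale)
  moreover have "continuous_on (U \<inter> sphere 0 1) q"
    unfolding q_def by (intro continuous_intros linear_continuous_on linear_conv_bounded_linear[THEN iffD1] lin)
  ultimately obtain v where v: "v \<in> U \<inter> sphere 0 1" "\<And>y. y \<in> U \<inter> sphere 0 1 \<Longrightarrow> q y \<le> q v"
    using continuous_attains_sup[of "U \<inter> sphere 0 1" q] by blast
  have nv: "norm v = 1" and vU: "v \<in> U" using v(1) by auto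
  define l where "l = q v"
  have q_le: "q y \<le> l * (y \<bullet> y)" if "y \<in> U" for y
  proof (cases "y = 0")
    case False
    have "q (y /\<^sub>R norm y) \<le> l"
      unfolding l_def using that False subU by (intro v(2)) (simp add: subspace_scale)
    moreover have "q (y /\<^sub>R norm y) = q y / (y \<bullet> y)"
      by (simp add: q_def linear_cmul[OF lin] divide_inverse power2_eq_square flip: power2_norm_eq_inner)
    moreover have "y \<bullet> y > 0" using False by simp
    ultimately show ?thesis by (simp add: pos_divide_le_eq)
  qed (simp add: q_def)
  define z where "z = H *v v - l *\<^sub>R v"
  have zU: "z \<in> U"
    unfolding z_def using HU vU subU by (simp add: subspace_diff subspace_scale)
  have "z \<bullet> z = 0"
  proof (rule zero_if_quadratic_nonpos)
    fix t :: real
    have "v + t *\<^sub>R z \<in> U" using vU zU subU by (simp add: subspace_add subspace_scale)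
    then have le: "q (v + t *\<^sub>R z) \<le> l * ((v + t *\<^sub>R z) \<bullet> (v + t *\<^sub>R z))" by (rule q_le)
    have "q (v + t *\<^sub>R z) = l + 2 * t * (z \<bullet> (H *v v)) + t\<^sup>2 * q z"
      using hermitian_form_real_symmetric[OF H, of v z]
      by (simp add: l_def q_def linear_add[OF lin] linear_cmul[OF lin] inner_add inner_commute
          power2_eq_square algebra_simps)
    moreover have "(v + t *\<^sub>R z) \<bullet> (v + t *\<^sub>R z) = 1 + 2 * t * (z \<bullet> v) + t\<^sup>2 * (z \<bullet> z)"
      using nv by (simp add: norm_eq_1 inner_add inner_commute power2_eq_square algebra_simps)
    moreover have "z \<bullet> z = z \<bullet> (H *v v - l *\<^sub>R v)" by (simp only: z_def)
    then have "z \<bullet> (H *v v) = z \<bullet> z + l * (z \<bullet> v)" by (simp add: inner_diff)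
    ultimately show "2 * t * (z \<bullet> z) + t\<^sup>2 * (q z - l * (z \<bullet> z)) \<le> 0"
      using le by (simp only: ring_distribs mult_ac)
  qed
  then have Hv: "H *v v = of_real l *s v" by (simp add: z_def scaleR_eq)
  show thesis
  proof
    show "v \<notin> S"
    proof
      assume "v \<in> S"
      then have "cinner v v = 0" using vU by (simp add: U_def)
      then show False using nv by (simp add: cinner_same)
    qed
    have "cinner y v = 0 \<and> cinner v y = 0" if "y \<in> S" for y
      using vU that by (metis (mono_tags, lifting) U_def cnj_cinner complex_cnj_zero mem_Collect_eq)
    then show "orthonormal_eigenvectors H (insert v S)"
      using S(1) nv Hv unfolding orthonormal_eigenvectors_def by auto
  qed
qed

lemma hermitian_eigenbasis:
  fixes H :: "complex^'n^'n"
  assumes "ctranspose H = H"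
  obtains v :: "'n \<Rightarrow> complex^'n" and l :: "'n \<Rightarrow> real" where
    "\<And>i j. cinner (v i) (v j) = (if i = j then 1 else 0)"
    "\<And>j. H *v v j = of_real (l j) *s v j"
proof -
  have "\<exists>S. orthonormal_eigenvectors H S \<and> card S = k" if "k \<le> CARD('n)" for k
    using that
  proof (induction k)
    case 0
    then show ?case by (intro exI[of _ "{}"]) (simp add: orthonormal_eigenvectors_def)
  next
    case (Suc k)
    then obtain S where S: "orthonormal_eigenvectors H S" "card S = k" by auto
    then obtain v where "v \<notin> S" "orthonormal_eigenvectors H (insert v S)"
      using extend_orthonormal_eigenvectors[OF assms S(1)] Suc.prems by auto
    moreover have "finite S" using S by (simp add: orthonormal_eigenvectors_def)
    ultimately show ?case using S(2) by (intro exI[of _ "insert v S"]) simp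
  qed
  then obtain S where S: "orthonormal_eigenvectors H S" "card S = CARD('n)" by blast
  then obtain v where v: "bij_betw v (UNIV :: 'n set) S"
    by (metis finite bij_betw_iff_card orthonormal_eigenvectors_def)
  have mem: "v j \<in> S" for j using v by (auto simp: bij_betw_def)
  have "\<exists>l :: real. H *v v j = of_real l *s v j" for j
    using S(1) mem by (auto simp: orthonormal_eigenvectors_def)
  then obtain l :: "'n \<Rightarrow> real" where "\<And>j. H *v v j = of_real (l j) *s v j" by metis
  moreover have "cinner (v i) (v j) = (if i = j then 1 else 0)" for i j
    using S(1) mem bij_betw_imp_inj_on[OF v] unfolding orthonormal_eigenvectors_def
    by (simp add: cinner_same inj_eq)
  ultimately show thesis using that by blast
qed

section \<open>Singular value decomposition\<close>

text \<open>
  Conjugating by \<open>V\<close> diagonalises \<open>H\<close>; the determinant is taken over the polynomial ring, into which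
  complex matrices are embedded by \<open>C\<close> as matrices of constant polynomials.
\<close>

lemma charpoly_eq_prod_of_eigenbasis:
  fixes H :: "complex^'n^'n" and V W :: "complex^'n^'n"
  assumes inv: "V ** W = mat 1" and eig: "\<And>j. H *v column j V = l j *s column j V"
  shows "charpoly H = (\<Prod>j\<in>UNIV. [:- l j, 1:])"
proof -
  define C :: "complex^'n^'n \<Rightarrow> complex poly^'n^'n" where "C M = (\<chi> i j. [:M $ i $ j:])" for M
  have C_mult: "C (M ** M') = C M ** C M'" for M M'
  proof -
    have const_sum: "[:\<Sum>k\<in>A. f k:] = (\<Sum>k\<in>A. [:f k:])" for f :: "'n \<Rightarrow> complex" and A
      by (simp add: poly_eq_iff coeff_sum coeff_pCons split: nat.split)
    show ?thesis
      by (simp add: C_def matrix_matrix_mult_def vec_eq_iff const_sum mult.commute)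
  qed
  define X :: "complex poly^'n^'n" where "X = (\<chi> i j. if i = j then [:0, 1:] else 0)"
  define D :: "complex poly^'n^'n" where "D = (\<chi> i j. if i = j then [:- l j, 1:] else 0)"
  have char: "charpoly H = det (X - C H)"
    unfolding charpoly_def X_def C_def
    by (rule arg_cong[where f = det]) (simp add: vec_eq_iff)
  have HV: "(H ** V) $ i $ j = l j * V $ i $ j" for i j
    using eig[of j]
    by (simp add: vec_eq_iff column_def matrix_vector_mult_def matrix_matrix_mult_def)
  have "(X - C H) ** C V = C V ** D"
  proof -
    have XV: "(X ** C V) $ i $ j = [:0, 1:] * [:V $ i $ j:]" for i j
      by (simp add: X_def C_def matrix_matrix_mult_def if_distrib if_distribR cong: if_cong)
    have VD: "(C V ** D) $ i $ j = [:V $ i $ j:] * [:- l j, 1:]" for i j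
      by (simp add: D_def C_def matrix_matrix_mult_def if_distrib if_distribR cong: if_cong)
    have "(C H ** C V) $ i $ j = [:l j * V $ i $ j:]" for i j
      by (simp only: C_mult[symmetric]) (simp add: C_def HV)
    moreover have "(X - C H) ** C V = X ** C V - C H ** C V"
      by (simp add: matrix_matrix_mult_def vec_eq_iff left_diff_distrib sum_subtractf)
    ultimately show ?thesis
      by (simp add: vec_eq_iff XV VD)
  qed
  then have "det (X - C H) * det (C V) = det (C V) * det D" by (metis det_mul)
  moreover have "det (C V) \<noteq> 0"
  proof -
    have "C V ** C W = mat 1"
      by (simp add: inv flip: C_mult) (simp add: C_def mat_def vec_eq_iff)
    then have "det (C V) * det (C W) = 1" by (metis det_mul det_I)
    then show ?thesis by auto
  qed
  ultimately have "det (X - C H) = det D" by (simp add: mult.commute)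
  also have "\<dots> = (\<Prod>j\<in>UNIV. [:- l j, 1:])"
    by (subst det_diagonal) (auto simp: D_def)
  finally show ?thesis using char by simp
qed

lemma list_with_decreasing_values:
  fixes f :: "'i::finite \<Rightarrow> real"
  obtains xs where "distinct xs" "set xs = UNIV" "sorted (rev (map f xs))"
proof -
  obtain ys :: "'i list" where "set ys = UNIV" "distinct ys"
    using finite_distinct_list[OF finite[of UNIV]] by blast
  then show thesis
    by (intro that[of "rev (sort_key f ys)"]) (simp_all add: rev_map[symmetric])
qed

text \<open>
  An orthonormal eigenbasis \<open>v\<close> of \<open>H = A\<^sup>* A\<close> gives \<open>A = A V V\<^sup>*\<close>, a sum of the rank-one matrices
  with factors \<open>A v j\<close> and \<open>cnj (v j)\<close>. The vectors \<open>A v j\<close> are orthogonal with squared norms the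
  eigenvalues, and by the factorisation of the characteristic polynomial these are the squares of
  the entries of the list of singular values. At most \<open>m\<close> of the \<open>A v j\<close> can be nonzero, so the sum may
  stop at \<open>min m n\<close>.
\<close>

lemma singular_value_decomposition:
  fixes A :: "complex^'n^'m"
  defines "N \<equiv> min CARD('m) CARD('n)"
  obtains u :: "nat \<Rightarrow> complex^'m" and w :: "nat \<Rightarrow> complex^'n" where
    "subunitary {1..N} u" "subunitary {1..N} w"
    "A = (\<Sum>j=1..N. singular_value A j *\<^sub>R outer (u j) (w j))"
    "\<And>j. 1 \<le> j \<Longrightarrow> j \<le> N \<Longrightarrow> singular_value A j \<noteq> 0 \<Longrightarrow> norm (u j) = 1 \<and> norm (w j) = 1"
    "\<And>i j. 1 \<le> i \<Longrightarrow> i \<le> j \<Longrightarrow> j \<le> N \<Longrightarrow> singular_value A j \<le> singular_value A i"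
    "\<And>j. 1 \<le> j \<Longrightarrow> j \<le> N \<Longrightarrow> 0 \<le> singular_value A j"
proof -
  define H where "H = ctranspose A ** A"
  have Hv: "H *v x = ctranspose A *v (A *v x)" for x
    by (simp add: H_def matrix_vector_mul_assoc)
  have "ctranspose H = H"
    by (simp add: H_def ctranspose_def matrix_matrix_mult_def vec_eq_iff mult.commute)
  then obtain v :: "'n \<Rightarrow> complex^'n" and l :: "'n \<Rightarrow> real" where
    v: "\<And>i j. cinner (v i) (v j) = (if i = j then 1 else 0)" and
    l: "\<And>j. H *v v j = of_real (l j) *s v j"
    using hermitian_eigenbasis by blast
  have AvAv: "cinner (A *v v i) (A *v v j) = (if i = j then of_real (l j) else 0)" for i j
  proof -
    have "cinner (A *v v i) (A *v v j) = cinner (H *v v i) (v j)"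
      by (simp only: Hv cinner_adjoint[of "A *v v i" A "v j"])
    then show ?thesis by (simp add: l cinner_scale_left v)
  qed
  have l_eq: "l j = (norm (A *v v j))\<^sup>2" for j
    using AvAv[of j j] unfolding cinner_same if_P[OF refl] of_real_eq_iff by simp
  define V :: "complex^'n^'n" where "V = (\<chi> a j. v j $ a)"
  have col_V: "column j V = v j" for j by (simp add: column_def V_def vec_eq_iff)
  have "ctranspose V ** V = mat 1"
    using v by (simp add: vec_eq_iff matrix_matrix_mult_def ctranspose_def V_def mat_def cinner_def)
  then have VV: "V ** ctranspose V = mat 1" using matrix_left_right_inverse by blast
  define s where "s j = sqrt (l j)" for j
  have s_nonneg: "0 \<le> s j" for j by (simp add: s_def l_eq)
  have s_sq: "(s j)\<^sup>2 = l j" for j by (simp add: s_def l_eq)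
  obtain xs where xs: "distinct xs" "set xs = UNIV" "sorted (rev (map s xs))"
    using list_with_decreasing_values by blast
  have len: "length xs = CARD('n)" using xs by (metis distinct_card)
  have sv: "singular_value_list A = map s xs"
  proof -
    have "charpoly H = (\<Prod>j\<in>UNIV. [:- of_real (l j), 1:])"
      using l by (intro charpoly_eq_prod_of_eigenbasis[OF VV]) (simp add: col_V)
    then have "proots (charpoly H) = (\<Sum>j\<in>UNIV. {#of_real (l j)#})"
      by (simp add: proots_prod)
    also have "\<dots> = mset (map (\<lambda>j. of_real (l j)) xs)"
      using xs(1,2) by (simp add: sum_unfold_sum_mset mset_set_set flip: mset_set_set)
    finally have "singular_value_list A = rev (sort (map s xs))"
      by (simp add: singular_value_list_def H_def[symmetric] s_def[abs_def] o_def image_mset.compositionality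
          flip: mset_map)
    also have "sort (map s xs) = rev (map s xs)"
      using xs(3) by (intro properties_for_sort) simp_all
    finally show ?thesis by simp
  qed
  define p where "p j = xs ! (j - 1)" for j
  have sv_p: "singular_value A j = s (p j)" if "1 \<le> j" "j \<le> CARD('n)" for j
    using that len by (simp add: singular_value_def sv p_def)
  have bij: "bij_betw p {1..CARD('n)} UNIV"
  proof -
    have "bij_betw (\<lambda>j. j - 1) {1..CARD('n)} {..<CARD('n)}"
      by (rule bij_betw_byWitness[where f' = Suc]) auto
    moreover have "bij_betw ((!) xs) {..<CARD('n)} UNIV"
      using bij_betw_nth[OF xs(1)] len xs(2) by simp
    ultimately have "bij_betw ((!) xs \<circ> (\<lambda>j. j - 1)) {1..CARD('n)} UNIV"
      by (rule bij_betw_trans)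
    then show ?thesis by (simp add: p_def[abs_def] o_def)
  qed
  have inj: "p i = p j \<longleftrightarrow> i = j" if "i \<in> {1..CARD('n)}" "j \<in> {1..CARD('n)}" for i j
    using inj_on_eq_iff[OF bij_betw_imp_inj_on[OF bij]] that by blast
  have mono: "s (p j) \<le> s (p i)" if "1 \<le> i" "i \<le> j" "j \<le> CARD('n)" for i j
  proof -
    have "map s xs ! (j - 1) \<le> map s xs ! (i - 1)"
      using that len by (intro sorted_rev_nth_mono[OF xs(3)]) auto
    then show ?thesis using that len by (simp add: p_def)
  qed
  \<comment> \<open>For \<open>s (p j) = 0\<close> the quotient is \<open>0\<close> by convention, so \<open>u j = 0\<close>.\<close>
  define u where "u j = of_real (1 / s (p j)) *s (A *v v (p j))" for j
  define w where "w j = (\<chi> b. cnj (v (p j) $ b))" for j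
  have cinner_u: "cinner (u i) (u j) = (if i = j \<and> s (p j) \<noteq> 0 then 1 else 0)"
    if "i \<in> {1..CARD('n)}" "j \<in> {1..CARD('n)}" for i j
    using inj[OF that] s_sq[of "p j"]
    by (auto simp: u_def cinner_scale_left cinner_scale_right AvAv power2_eq_square
        simp flip: of_real_mult)
  have cinner_w: "cinner (w i) (w j) = (if i = j then 1 else 0)"
    if "i \<in> {1..CARD('n)}" "j \<in> {1..CARD('n)}" for i j
  proof -
    have "cinner (w i) (w j) = cnj (cinner (v (p i)) (v (p j)))"
      by (simp add: cinner_def w_def)
    then show ?thesis using inj[OF that] by (simp add: v)
  qed
  have norm_1_if: "norm x = 1" if "cinner x x = 1" for x :: "complex^'k"
    using that norm_ge_zero[of x] unfolding cinner_same of_real_eq_1_iff power2_eq_1_iff by linarith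
  have norm_0_if: "norm x = 0" if "cinner x x = 0" for x :: "complex^'k"
    using that unfolding cinner_same by simp
  have norm_w: "norm (w j) = 1" if "j \<in> {1..CARD('n)}" for j
    using cinner_w[OF that that] by (intro norm_1_if) simp
  have norm_u: "norm (u j) = (if s (p j) = 0 then 0 else 1)" if "j \<in> {1..CARD('n)}" for j
    using cinner_u[OF that that] norm_1_if[of "u j"] norm_0_if[of "u j"] by auto
  have sub_u: "subunitary J u" if "J \<subseteq> {1..CARD('n)}" for J
    unfolding subunitary_def
  proof (intro conjI ballI impI)
    show "norm (u j) \<le> 1" if "j \<in> J" for j
      using norm_u[of j] \<open>J \<subseteq> _\<close> that by auto
    show "cinner (u i) (u j) = 0" if "i \<in> J" "j \<in> J" "i \<noteq> j" for i j
      using cinner_u[of i j] \<open>J \<subseteq> _\<close> that by (auto simp: subset_iff)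
  qed
  have zero_beyond: "s (p j) = 0" if "N < j" "j \<le> CARD('n)" for j
  proof (rule ccontr)
    assume "s (p j) \<noteq> 0"
    then have "s (p i) \<noteq> 0" if "i \<in> {1..j}" for i
      using mono[of i j] that s_nonneg[of "p j"] \<open>j \<le> _\<close> by (auto simp: less_le)
    then have "card {1..j} \<le> CARD('m)"
      using \<open>j \<le> _\<close> norm_u by (intro card_orthonormal_le_dimension[of _ u] sub_u) auto
    then show False using that by (simp add: N_def)
  qed
  have N_le: "N \<le> CARD('n)" by (simp add: N_def)
  have expansion: "A = (\<Sum>j=1..CARD('n). s (p j) *\<^sub>R outer (u j) (w j))"
  proof -
    have "A = A ** (V ** ctranspose V)" by (simp add: VV)
    also have "\<dots> = (A ** V) ** ctranspose V" by (rule matrix_mul_assoc)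
    also have "\<dots> = (\<Sum>k\<in>UNIV. outer (A *v v k) (\<chi> b. cnj (v k $ b)))"
      by (simp add: vec_eq_iff outer_def matrix_matrix_mult_def matrix_vector_mult_def
          ctranspose_def V_def)
    also have "\<dots> = (\<Sum>j=1..CARD('n). outer (A *v v (p j)) (\<chi> b. cnj (v (p j) $ b)))"
      by (rule sum.reindex_bij_betw[OF bij, symmetric])
    also have "\<dots> = (\<Sum>j=1..CARD('n). s (p j) *\<^sub>R outer (u j) (w j))"
    proof (rule sum.cong[OF refl])
      fix j
      have "A *v v (p j) = of_real (s (p j)) *s u j"
      proof (cases "s (p j) = 0")
        case True
        then have "l (p j) = 0" using s_sq[of "p j"] by simp
        then show ?thesis using True l_eq[of "p j"] by (simp add: vec_eq_iff)
      qed (simp add: u_def vec_eq_iff)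
      then show "outer (A *v v (p j)) (\<chi> b. cnj (v (p j) $ b)) = s (p j) *\<^sub>R outer (u j) (w j)"
        by (simp add: outer_def w_def vec_eq_iff scaleR_conv_of_real[where 'a = complex])
    qed
    finally show ?thesis .
  qed
  show thesis
  proof
    show "subunitary {1..N} u" using N_le by (intro sub_u) simp
    show "subunitary {1..N} w"
      using cinner_w norm_w N_le by (simp add: subunitary_def)
    have "A = (\<Sum>j=1..N. s (p j) *\<^sub>R outer (u j) (w j))"
      unfolding expansion using N_le zero_beyond by (intro sum.mono_neutral_right) auto
    also have "\<dots> = (\<Sum>j=1..N. singular_value A j *\<^sub>R outer (u j) (w j))"
      using N_le by (intro sum.cong) (simp_all add: sv_p)
    finally show "A = (\<Sum>j=1..N. singular_value A j *\<^sub>R outer (u j) (w j))" .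
    fix j assume j: "1 \<le> j" "j \<le> N"
    then have j': "j \<le> CARD('n)" "j \<in> {1..CARD('n)}" using N_le by auto
    show "0 \<le> singular_value A j" using sv_p s_nonneg j j' by simp
    show "norm (u j) = 1 \<and> norm (w j) = 1" if "singular_value A j \<noteq> 0"
      using that norm_u norm_w j j' by (simp add: sv_p)
  next
    fix i j assume "1 \<le> i" "i \<le> j" "j \<le> N"
    then show "singular_value A j \<le> singular_value A i"
      using mono[of i j] N_le by (simp add: sv_p)
  qed
qed

section \<open>Conjugates of extended-real-valued functions\<close>

lemma fenchel_conjugate_ge: "ereal (A \<bullet> B) - f A \<le> fenchel_conjugate f B"
  unfolding fenchel_conjugate_def by (rule SUP_upper) simp

lemma fenchel_biconjugate_le: "fenchel_conjugate (fenchel_conjugate f) \<le> f"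
proof (rule le_funI)
  fix A
  show "fenchel_conjugate (fenchel_conjugate f) A \<le> f A"
    unfolding fenchel_conjugate_def[of "fenchel_conjugate f"]
  proof (rule SUP_least)
    fix B
    have "ereal (A \<bullet> B) - f A \<le> fenchel_conjugate f B" by (rule fenchel_conjugate_ge)
    then show "ereal (B \<bullet> A) - fenchel_conjugate f B \<le> f A"
      by (cases "f A"; cases "fenchel_conjugate f B") (auto simp: inner_commute)
  qed
qed

lemma convex_fenchel_conjugate: "convex_ereal (fenchel_conjugate f)"
proof -
  have "{(x, r). fenchel_conjugate f x \<le> ereal r} =
      (\<Inter>A. {(x, r). ereal (A \<bullet> x) - f A \<le> ereal r})"
    by (auto simp: fenchel_conjugate_def SUP_le_iff)
  moreover have "convex {(x, r). ereal (A \<bullet> x) - f A \<le> ereal r}" for A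
  proof (cases "f A")
    case (real c)
    have "{(x, r). ereal (A \<bullet> x) - f A \<le> ereal r} = {p. (A, - 1) \<bullet> p \<le> c}"
      using real by auto
    then show ?thesis by (simp add: convex_halfspace_le)
  qed (simp_all add: case_prod_unfold)
  ultimately show ?thesis
    unfolding convex_ereal_def by (simp add: convex_INT)
qed

text \<open>
  Such sets are sections of the epigraph along the graph of an affine function. They turn convexity
  of an extended-real-valued function into a statement about ordinary convex sets.
\<close>

lemma convex_below_affine:
  assumes "convex_ereal g"
  shows "convex {x. g (p + x) \<le> ereal (a \<bullet> x + b)}" (is "convex ?S")
proof (rule convexI)
  fix x y and r t :: real
  assume *: "x \<in> ?S" "y \<in> ?S" "0 \<le> r" "0 \<le> t" "r + t = 1"
  have "r *\<^sub>R (p + x, a \<bullet> x + b) + t *\<^sub>R (p + y, a \<bullet> y + b) \<in> {(x, r). g x \<le> ereal r}"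
    using * assms unfolding convex_ereal_def by (intro convexD) auto
  moreover have "r *\<^sub>R (p + x) + t *\<^sub>R (p + y) = (r + t) *\<^sub>R p + (r *\<^sub>R x + t *\<^sub>R y)"
    by (simp add: algebra_simps)
  moreover have "r * (a \<bullet> x + b) + t * (a \<bullet> y + b) = a \<bullet> (r *\<^sub>R x + t *\<^sub>R y) + (r + t) * b"
    by (simp add: algebra_simps inner_add)
  ultimately show "r *\<^sub>R x + t *\<^sub>R y \<in> ?S"
    using \<open>r + t = 1\<close> by simp
qed

section \<open>The two bounds for the biconjugate\<close>

lemma norm_diff_squared:
  fixes A F :: "'a::real_inner"
  shows "(norm (A - F))\<^sup>2 = (norm A)\<^sup>2 - 2 * (A \<bullet> F) + (norm F)\<^sup>2"
  by (simp add: power2_norm_eq_inner inner_diff inner_commute)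

text \<open>
  Singular value decomposition data together with an index \<open>k\<close> for which the tail after position
  \<open>K - k\<close> is balanced: its largest entry is at most \<open>s\<close>, while its entry sum is \<open>s * k\<close>. The tail
  is therefore a convex combination of vectors that equal \<open>s\<close> at \<open>k\<close> positions and vanish elsewhere.
  The last assumption keeps the sequence nonincreasing when the tail is replaced by the constant \<open>s\<close>.
\<close>

locale balanced_svd =
  fixes N K k :: nat and \<alpha> :: "nat \<Rightarrow> real" and s :: real
    and u :: "nat \<Rightarrow> complex^'m" and w :: "nat \<Rightarrow> complex^'n"
  assumes k: "1 \<le> k" "k \<le> K" and K_le: "K \<le> N"
    and u: "subunitary {1..N} u" and w: "subunitary {1..N} w"
    and unit: "\<And>j. 1 \<le> j \<Longrightarrow> j \<le> N \<Longrightarrow> \<alpha> j \<noteq> 0 \<Longrightarrow> norm (u j) = 1 \<and> norm (w j) = 1"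
    and mono: "\<And>i j. 1 \<le> i \<Longrightarrow> i \<le> j \<Longrightarrow> j \<le> N \<Longrightarrow> \<alpha> j \<le> \<alpha> i"
    and nonneg: "\<And>j. 1 \<le> j \<Longrightarrow> j \<le> N \<Longrightarrow> 0 \<le> \<alpha> j"
    and mean: "sum \<alpha> {K - k + 1..N} = s * real k"
    and tail: "\<alpha> (K - k + 1) \<le> s" and head: "1 \<le> K - k \<Longrightarrow> s \<le> \<alpha> (K - k)"
begin

definition E :: "nat \<Rightarrow> complex^'n^'m" where
  "E j = outer (u j) (w j)"

definition A :: "complex^'n^'m" where
  "A = (\<Sum>j=1..N. \<alpha> j *\<^sub>R E j)"

text \<open>
  The coefficients of the matrix \<open>Y\<close> that gives the lower bound: the head of \<open>\<alpha>\<close> is kept and the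
  tail flattened to \<open>s\<close>. The combinations of \<open>K\<close> of the \<open>E j\<close> that average to \<open>A\<close> carry the same
  coefficients, which is why the two bounds meet.
\<close>

definition c :: "nat \<Rightarrow> real" where
  "c j = (if j \<le> K - k then \<alpha> j else s)"

text \<open>
  The value at which the two bounds meet: the common bound for the squared norms of the
  low-rank matrices that average to \<open>A\<close>, and the supremum over all matrices \<open>Z\<close> of
  \<open>2 * (A \<bullet> Z)\<close> minus the sum of the \<open>K\<close> largest squared singular values of \<open>Z\<close>.
\<close>

definition V :: real where
  "V = (\<Sum>j=1..K-k. (\<alpha> j)\<^sup>2) + real k * s\<^sup>2"

lemma split_indices: "{1..N} = {1..K-k} \<union> {K-k+1..N}" "{1..K} = {1..K-k} \<union> {K-k+1..K}"
  using k K_le by auto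

lemma sum_split: "sum f {1..N} = sum f {1..K-k} + sum f {K-k+1..N}" for f :: "nat \<Rightarrow> 'a::comm_monoid_add"
  unfolding split_indices(1) by (rule sum.union_disjoint) auto

lemma sum_c_squared: "(\<Sum>j=1..K. (c j)\<^sup>2) = V"
proof -
  have "(\<Sum>j=1..K. (c j)\<^sup>2) = (\<Sum>j=1..K-k. (c j)\<^sup>2) + (\<Sum>j=K-k+1..K. (c j)\<^sup>2)"
    unfolding split_indices(2) by (rule sum.union_disjoint) auto
  moreover have "(\<Sum>j=1..K-k. (c j)\<^sup>2) = (\<Sum>j=1..K-k. (\<alpha> j)\<^sup>2)" by (simp add: c_def)
  moreover have "(\<Sum>j=K-k+1..K. (c j)\<^sup>2) = (\<Sum>j=K-k+1..K. s\<^sup>2)" by (simp add: c_def)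
  ultimately show ?thesis using k by (simp add: V_def)
qed

lemma tail_bounds: "0 \<le> \<alpha> j \<and> \<alpha> j \<le> s" if "j \<in> {K - k + 1..N}"
  using mono[of "K - k + 1" j] nonneg[of j] tail that by auto

text \<open>
  \<open>A\<close> is a convex combination of the matrices \<open>P + (\<Sum>j\<in>I. s *\<^sub>R E j)\<close> with \<open>P\<close> the
  head of the decomposition and \<open>I\<close> a \<open>k\<close>-element set of tail positions. These have rank at most \<open>K\<close> and squared norm at most \<open>V\<close>, so there the
  functional is below \<open>X \<mapsto> V - 2 * (X \<bullet> F) + (norm F)\<^sup>2\<close>. As this bound is affine in \<open>X\<close>, a convex
  minorant satisfies it at \<open>A\<close> as well.
\<close>

lemma convex_minorant_le:
  assumes g: "convex_ereal g" "g \<le> rank_functional K F"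
  shows "g A \<le> ereal (V - 2 * (A \<bullet> F) + (norm F)\<^sup>2)"
proof -
  define P where "P = (\<Sum>j=1..K-k. \<alpha> j *\<^sub>R E j)"
  define T where "T = {K-k+1..N}"
  define C where "C = {X. g (P + X) \<le> ereal ((- 2 *\<^sub>R F) \<bullet> X + (V - 2 * (P \<bullet> F) + (norm F)\<^sup>2))}"
  have bound_eq: "(- 2 *\<^sub>R F) \<bullet> X + (V - 2 * (P \<bullet> F) + (norm F)\<^sup>2) =
      V - 2 * ((P + X) \<bullet> F) + (norm F)\<^sup>2" for X
    by (simp add: inner_add inner_commute)
  have "convex C" unfolding C_def by (rule convex_below_affine[OF g(1)])
  moreover have "(\<lambda>I. \<Sum>j\<in>I. s *\<^sub>R E j) ` {I. I \<subseteq> T \<and> card I = k} \<subseteq> C"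
  proof safe
    fix I assume I: "I \<subseteq> T" "k = card I"
    then have cardI: "card I = k" by simp
    define J where "J = {1..K-k} \<union> I"
    have fin: "finite I" using I(1) by (auto simp: T_def intro: finite_subset)
    have disj: "{1..K-k} \<inter> I = {}" using I(1) by (auto simp: T_def)
    have JN: "J \<subseteq> {1..N}" using I(1) k K_le by (auto simp: J_def T_def)
    have cardJ: "card J = K" unfolding J_def using fin disj cardI k by (simp add: card_Un_disjoint)
    have sum_J: "sum f J = sum f {1..K-k} + sum f I" for f :: "nat \<Rightarrow> 'z::comm_monoid_add"
      unfolding J_def using fin disj by (intro sum.union_disjoint) auto
    have c_I: "c j = s" if "j \<in> I" for j using that I(1) by (auto simp: c_def T_def)
    have X: "P + (\<Sum>j\<in>I. s *\<^sub>R E j) = (\<Sum>j\<in>J. c j *\<^sub>R outer (u j) (w j))"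
      unfolding sum_J by (simp add: P_def c_I flip: E_def) (simp add: c_def)
    have rank: "rank (P + (\<Sum>j\<in>I. s *\<^sub>R E j)) \<le> K"
      unfolding X using rank_sum_outer_le[of J J c u w] cardJ by (simp add: J_def fin)
    have "(norm (P + (\<Sum>j\<in>I. s *\<^sub>R E j)))\<^sup>2 \<le> (\<Sum>j\<in>J. (c j)\<^sup>2)"
      unfolding X using fin JN u w by (intro norm_sum_outer_le) (auto simp: J_def intro: subunitary_subset)
    also have "\<dots> = V"
      unfolding sum_J by (simp add: c_I V_def cardI) (simp add: c_def)
    finally have norm: "(norm (P + (\<Sum>j\<in>I. s *\<^sub>R E j)))\<^sup>2 \<le> V" .
    have "g (P + (\<Sum>j\<in>I. s *\<^sub>R E j)) \<le> rank_functional K F (P + (\<Sum>j\<in>I. s *\<^sub>R E j))"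
      using g(2) by (rule le_funD)
    also have "\<dots> \<le> ereal (V - 2 * ((P + (\<Sum>j\<in>I. s *\<^sub>R E j)) \<bullet> F) + (norm F)\<^sup>2)"
      using rank norm by (simp add: rank_functional_def rank_indicator_def norm_diff_squared)
    finally show "(\<Sum>j\<in>I. s *\<^sub>R E j) \<in> C" unfolding C_def bound_eq by simp
  qed
  ultimately have "convex hull ((\<lambda>I. \<Sum>j\<in>I. s *\<^sub>R E j) ` {I. I \<subseteq> T \<and> card I = k}) \<subseteq> C"
    by (intro hull_minimal)
  moreover have "(\<Sum>j\<in>T. \<alpha> j *\<^sub>R E j) \<in>
      convex hull ((\<lambda>I. \<Sum>j\<in>I. s *\<^sub>R E j) ` {I. I \<subseteq> T \<and> card I = k})"
    using k K_le mean tail_bounds by (intro balanced_sum_in_convex_hull) (auto simp: T_def)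
  ultimately have "(\<Sum>j\<in>T. \<alpha> j *\<^sub>R E j) \<in> C" by blast
  moreover have "A = P + (\<Sum>j\<in>T. \<alpha> j *\<^sub>R E j)"
    unfolding A_def P_def T_def by (rule sum_split)
  ultimately show ?thesis unfolding C_def bound_eq by simp
qed

lemma norm_A: "(norm A)\<^sup>2 = (\<Sum>j=1..N. (\<alpha> j)\<^sup>2)"
  and inner_A: "A \<bullet> (\<Sum>j=1..N. c j *\<^sub>R E j) = V"
proof -
  have unit': "\<alpha> j * ((norm (u j))\<^sup>2 * (norm (w j))\<^sup>2) = \<alpha> j" if "j \<in> {1..N}" for j
    using unit[of j] that by (cases "\<alpha> j = 0") auto
  have inner: "A \<bullet> (\<Sum>j=1..N. b j *\<^sub>R E j) = (\<Sum>j=1..N. \<alpha> j * b j)" for b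
  proof -
    have "A \<bullet> (\<Sum>j=1..N. b j *\<^sub>R E j) = (\<Sum>j=1..N. b j * (\<alpha> j * ((norm (u j))\<^sup>2 * (norm (w j))\<^sup>2)))"
      unfolding A_def E_def inner_sum_outer[OF finite_atLeastAtMost u w] by (simp add: mult_ac)
    also have "\<dots> = (\<Sum>j=1..N. \<alpha> j * b j)"
      by (intro sum.cong refl) (simp only: unit' mult.commute)
    finally show ?thesis .
  qed
  show "(norm A)\<^sup>2 = (\<Sum>j=1..N. (\<alpha> j)\<^sup>2)"
    using inner[of \<alpha>] unfolding power2_norm_eq_inner by (simp add: A_def power2_eq_square)
  have "(\<Sum>j=1..N. \<alpha> j * c j) = (\<Sum>j=1..K-k. (\<alpha> j)\<^sup>2) + (\<Sum>j=K-k+1..N. \<alpha> j * s)"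
    unfolding sum_split by (simp add: c_def power2_eq_square)
  also have "(\<Sum>j=K-k+1..N. \<alpha> j * s) = real k * s\<^sup>2"
    using mean by (simp add: power2_eq_square flip: sum_distrib_right)
  finally show "A \<bullet> (\<Sum>j=1..N. c j *\<^sub>R E j) = V" unfolding inner V_def .
qed

text \<open>
  The bound comes from a single affine minorant of the functional, the one with slope
  \<open>G = 2 *\<^sub>R (Y - F)\<close>; its height is controlled by the Eckart--Young bound.
\<close>

lemma biconjugate_ge:
  "ereal (V - 2 * (A \<bullet> F) + (norm F)\<^sup>2) \<le>
     fenchel_conjugate (fenchel_conjugate (rank_functional K F)) A"
proof -
  define Y where "Y = (\<Sum>j=1..N. c j *\<^sub>R E j)"
  define G where "G = 2 *\<^sub>R (Y - F)"
  have "K - k + 1 \<le> K" using k by linarith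
  then have s_nonneg: "0 \<le> s" using tail_bounds[of K] K_le by fastforce
  have "c j \<le> c i" if "1 \<le> i" "i \<le> j" "j \<le> N" for i j
    using that mono[of i j] mono[of i "K - k"] head K_le by (auto simp: c_def)
  moreover have "0 \<le> c j" if "1 \<le> j" "j \<le> N" for j
    using that nonneg s_nonneg by (simp add: c_def)
  ultimately have EY: "2 * (B \<bullet> Y) - (norm B)\<^sup>2 \<le> V" if "rank B \<le> K" for B
    unfolding Y_def E_def sum_c_squared[symmetric]
    using k K_le u w that by (intro eckart_young_bound) auto
  have "fenchel_conjugate (rank_functional K F) G \<le> ereal (V - (norm F)\<^sup>2)"
    unfolding fenchel_conjugate_def
  proof (rule SUP_least)
    fix B :: "complex^'n^'m"
    have "B \<bullet> G - (norm (B - F))\<^sup>2 = 2 * (B \<bullet> Y) - (norm B)\<^sup>2 - (norm F)\<^sup>2"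
      by (simp add: G_def norm_diff_squared inner_diff)
    then show "ereal (B \<bullet> G) - rank_functional K F B \<le> ereal (V - (norm F)\<^sup>2)"
      using EY[of B] by (simp add: rank_functional_def rank_indicator_def)
  qed
  then have "ereal (G \<bullet> A) - ereal (V - (norm F)\<^sup>2) \<le> ereal (G \<bullet> A) - fenchel_conjugate (rank_functional K F) G"
    by (rule ereal_minus_mono[OF order_refl])
  also have "\<dots> \<le> fenchel_conjugate (fenchel_conjugate (rank_functional K F)) A"
    by (rule fenchel_conjugate_ge)
  finally have "ereal (G \<bullet> A - (V - (norm F)\<^sup>2)) \<le>
      fenchel_conjugate (fenchel_conjugate (rank_functional K F)) A"
    by simp
  moreover have "G \<bullet> A - (V - (norm F)\<^sup>2) = V - 2 * (A \<bullet> F) + (norm F)\<^sup>2"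
    using inner_A by (simp add: G_def Y_def inner_diff inner_commute)
  ultimately show ?thesis by simp
qed

lemma value_eq:
  "V - 2 * (A \<bullet> F) + (norm F)\<^sup>2 =
    1 / real k * (\<Sum>j = K - k + 1..N. \<alpha> j)\<^sup>2 - (\<Sum>j = K - k + 1..N. (\<alpha> j)\<^sup>2) + (norm (A - F))\<^sup>2"
  unfolding norm_diff_squared norm_A sum_split mean V_def
  using k by (simp add: power2_eq_square)

end

theorem theorem1:
  fixes F :: "complex^'n^'m" and K :: nat
  assumes "1 \<le> K" and "K < min CARD('m) CARD('n)"
  shows "is_convex_envelope (rank_functional K F)
           (fenchel_conjugate (fenchel_conjugate (rank_functional K F))) \<and>
         (\<forall>A :: complex^'n^'m.
            let N = min CARD('m) CARD('n); \<alpha> = singular_value A; k = k_star N K \<alpha> in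
              fenchel_conjugate (fenchel_conjugate (rank_functional K F)) A =
              ereal (1 / real k * (\<Sum>j = K - k + 1..N. \<alpha> j)\<^sup>2
                     - (\<Sum>j = K - k + 1..N. (\<alpha> j)\<^sup>2) + (norm (A - F))\<^sup>2))"
proof -
  define f where "f = rank_functional K F"
  define N where "N = min CARD('m) CARD('n)"
  define val where "val A = (let \<alpha> = singular_value A; k = k_star N K \<alpha> in
      1 / real k * (\<Sum>j = K - k + 1..N. \<alpha> j)\<^sup>2 - (\<Sum>j = K - k + 1..N. (\<alpha> j)\<^sup>2) + (norm (A - F))\<^sup>2)"
    for A :: "complex^'n^'m"
  have bounds: "ereal (val A) \<le> fenchel_conjugate (fenchel_conjugate f) A \<and>
      (\<forall>g. convex_ereal g \<and> g \<le> f \<longrightarrow> g A \<le> ereal (val A))" for A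
  proof -
    define \<alpha> where "\<alpha> = singular_value A"
    define k where "k = k_star N K \<alpha>"
    obtain u :: "nat \<Rightarrow> complex^'m" and w :: "nat \<Rightarrow> complex^'n" where svd:
      "subunitary {1..N} u" "subunitary {1..N} w" "A = (\<Sum>j=1..N. \<alpha> j *\<^sub>R outer (u j) (w j))"
      "\<And>j. 1 \<le> j \<Longrightarrow> j \<le> N \<Longrightarrow> \<alpha> j \<noteq> 0 \<Longrightarrow> norm (u j) = 1 \<and> norm (w j) = 1"
      "\<And>i j. 1 \<le> i \<Longrightarrow> i \<le> j \<Longrightarrow> j \<le> N \<Longrightarrow> \<alpha> j \<le> \<alpha> i"
      "\<And>j. 1 \<le> j \<Longrightarrow> j \<le> N \<Longrightarrow> 0 \<le> \<alpha> j"
      by (rule singular_value_decomposition[of A, folded \<alpha>_def N_def]) (rule that; assumption)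
    have K: "1 \<le> K" "K < N" using assms by (simp_all add: N_def)
    have "is_k_star N K \<alpha> k"
      unfolding k_def k_star_def by (rule theI'[OF ex1_k_star[OF K svd(5,6)]])
    then have k: "1 \<le> k" "k \<le> K" "\<alpha> (K - k + 1) \<le> sum \<alpha> {K - k + 1..N} / real k"
      "ereal (sum \<alpha> {K - k + 1..N} / real k) < extend_zero \<alpha> (K - k)"
      by (auto simp: is_k_star_def)
    interpret D: balanced_svd N K k \<alpha> "sum \<alpha> {K - k + 1..N} / real k" u w
      by unfold_locales (use K k svd in \<open>auto simp: extend_zero_def split: if_splits\<close>)
    have "D.A = A" unfolding D.A_def D.E_def by (rule svd(3)[symmetric])
    moreover have "val A = 1 / real k * (\<Sum>j = K - k + 1..N. \<alpha> j)\<^sup>2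
        - (\<Sum>j = K - k + 1..N. (\<alpha> j)\<^sup>2) + (norm (A - F))\<^sup>2"
      by (simp add: val_def Let_def \<alpha>_def k_def)
    ultimately show ?thesis
      using D.convex_minorant_le[of _ F] D.biconjugate_ge[of F] D.value_eq[of F]
      unfolding f_def by metis
  qed
  have biconj: "convex_ereal (fenchel_conjugate (fenchel_conjugate f))"
    "fenchel_conjugate (fenchel_conjugate f) \<le> f"
    by (rule convex_fenchel_conjugate fenchel_biconjugate_le)+
  then have eq: "fenchel_conjugate (fenchel_conjugate f) A = ereal (val A)" for A
    using bounds[of A] by (intro antisym) auto
  have "is_convex_envelope f (fenchel_conjugate (fenchel_conjugate f))"
    unfolding is_convex_envelope_def using biconj bounds eq by (auto simp: le_fun_def)
  then show ?thesis
    using eq unfolding f_def val_def N_def by (simp add: Let_def)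
qed

end
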